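(* Let $n\ge 1$, let $\mathbf{k}=(k_1,\dots,k_n)$ be a weak composition of $n$, and let $i$ be the index of the rightmost $0$ in $\mathbf{k}$ (with $i=c$ if $\mathbf{k}=(1,\dots,1)$). Then the map $$\pi_{\mathrm{lazy}}:\mathrm{Tour}(\mathbf{k})\to\coprod_{j>i}\mathrm{Tour}(\widetilde{\mathbf{k}}_j)$$ is a bijection.
   Context: **Weak compositions and the tilde construction.** A weak composition $\mathbf{k}=(k_1,\dots,k_n)$ of $n$ here means a sequence of $n$ nonnegative integers with sum $n$. Let $i=\max\{\ell:k_\ell=0\}$, with the convention $i=c$ if $\mathbf{k}=(1,1,\dots,1)$. For $j>i$ with $j\in\{1,\dots,n\}$ (all $j\in\{1,\dots,n\}$ are allowed if $i=c$), $\widetilde{\mathbf{k}}_j$ is the weak composition of $n-1$ of length $n-1$ obtained by decreasing $k_j$ by $1$ and then removing the rightmost $0$ in the resulting sequence. **Trees.** Let $X_n=\{a,b,c,1,\dots,n\}$, ordered by $a<b<c<1<2<\cdots<n$. A trivalent tree is a finite tree in which every vertex has degree $1$ or $3$ and at least one vertex has degree $3$. It is leaf-labeled by $X_n$ if its leaves are in bijection with $X_n$; such trees are considered up to label-preserving isomorphism. A leaf edge is an edge incident to a leaf. **Lazy tournament** of a leaf-labeled trivalent tree $T$: a labeling of the edges of $T$ computed as follows. Label each leaf edge by the label of its leaf. Then repeat the following round until all edges are labeled. (1) Among all pairs of labeled edges $(i,j)$ (written by their labels, with $i<j$) that share a vertex whose third edge $E$ is unlabeled, choose the pair with the largest value of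 $i$; $i$ and $j$ face off (compete) in this round. (2) The larger label $j$ wins the round and the smaller label $i$ loses it. (3) If $E$ is adjacent to a labeled edge with label $u\ne j$ and $u>i$, label $E$ by $i$ ($i$ advances); this is the laziness rule. Otherwise label $E$ by $j$ ($j$ advances). **Tour.** $\mathrm{Tour}(\mathbf{k})$ is the set of trivalent trees with leaves labeled by $X_n$ in which the leaf edges $a$ and $b$ share a vertex, and each label $i\in\{1,\dots,n\}$ wins exactly $k_i$ rounds of the lazy tournament. For $n=0$, $\mathrm{Tour}(\emptyset)=\{T_0\}$ where $T_0$ is the unique trivalent tree with leaves $a,b,c$. **The map $\pi_{\mathrm{lazy}}$.** $\coprod$ denotes formal disjoint union of sets. For $T\in\mathrm{Tour}(\mathbf{k})$, let $(i,j)$ with $i<j$ be the pair that faces off first in the tournament of $T$ (it is known that this $i$ is the index of the rightmost $0$ of $\mathbf{k}$, with the convention that this index is $c$ if $\mathbf{k}=(1,1,\dots,1)$), and let $v$ be the vertex at which the leaf edges $i$ and $j$ meet. If $k_j>1$, then $\pi_{\mathrm{lazy}}(T)$ is the tree formed by labeling $v$ by $j$, removing the leaves and leaf edges of $i$ and $j$, and decreasing all of the labels $i+1,i+2,\dots,n$ by $1$ (so $v$ becomes a leaf with label $j-1$). If $k_j=1$, then $\pi_{\mathrm{lazy}}(T)$ is the tree formed by labeling $v$ by $i$, removing the leaves and leaf edges of $i$ and $j$, and decreasing all of the labels $j+1,\dots,n$ by $1$. The tree $\pi_{\mathrm{lazy}}(T)$ is regarded as an element of the summand $\mathrm{Tour}(\widetilde{\mathbf{k}}_j)$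 indexed by $j$. *)

theory Defs
  imports Main
begin

text \<open>
  Labels are integers. The ordered set of labels \<open>a < b < c < 1 < 2 < \<dots> < n\<close> is
  the interval from \<open>-2\<close> to \<open>n\<close>, with \<open>a, b, c\<close> in the first three places.
\<close>

abbreviation label_a :: int where "label_a \<equiv> -2"
abbreviation label_b :: int where "label_b \<equiv> -1"
abbreviation label_c :: int where "label_c \<equiv> 0"

definition labels :: "nat \<Rightarrow> int set" where
  "labels n = {label_a, label_b, label_c} \<union> {1..int n}"


subsection \<open>Weak compositions\<close>

text \<open>The entry \<open>k\<^sub>j\<close>, for \<open>1 \<le> j \<le> n\<close>, sits at list position \<open>j - 1\<close>.\<close>

definition weak_composition :: "nat \<Rightarrow> nat list \<Rightarrow> bool" where
  "weak_composition n k \<longleftrightarrow> length k = n \<and> sum_list k = n"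

definition entry :: "nat list \<Rightarrow> int \<Rightarrow> nat" where
  "entry k j = k ! (nat j - 1)"

definition rightmost_zero :: "nat list \<Rightarrow> int" where
  "rightmost_zero k =
     (if \<forall>l\<in>{1..int (length k)}. entry k l = 1 then label_c
      else Max {l \<in> {1..int (length k)}. entry k l = 0})"

definition remove_rightmost_zero :: "nat list \<Rightarrow> nat list" where
  "remove_rightmost_zero k = rev (remove1 0 (rev k))"

definition tilde :: "nat list \<Rightarrow> int \<Rightarrow> nat list" where
  "tilde k j = remove_rightmost_zero (k[nat j - 1 := entry k j - 1])"


subsection \<open>Leaf-labeled trivalent trees\<close>

text \<open>
  Every finite tree is isomorphic to one whose vertices are natural numbers, so these represent
  all isomorphism classes. Only the values of \<open>label\<close> on the leaves are meaningful.
\<close>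

record tree =
  verts :: "nat set"
  edges :: "nat set set"
  label :: "nat \<Rightarrow> int"

definition incident :: "tree \<Rightarrow> nat \<Rightarrow> nat set set" where
  "incident T v = {e \<in> edges T. v \<in> e}"

definition degree :: "tree \<Rightarrow> nat \<Rightarrow> nat" where
  "degree T v = card (incident T v)"

definition leaves :: "tree \<Rightarrow> nat set" where
  "leaves T = {v \<in> verts T. degree T v = 1}"

definition finite_simple_graph :: "tree \<Rightarrow> bool" where
  "finite_simple_graph T \<longleftrightarrow> finite (verts T) \<and>
     (\<forall>e\<in>edges T. \<exists>u\<in>verts T. \<exists>v\<in>verts T. u \<noteq> v \<and> e = {u, v})"

definition connected_graph :: "tree \<Rightarrow> bool" where
  "connected_graph T \<longleftrightarrow> verts T \<noteq> {} \<and>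
     (\<forall>u\<in>verts T. \<forall>v\<in>verts T. (u, v) \<in> {(x, y). {x, y} \<in> edges T}\<^sup>*)"

definition cycle :: "tree \<Rightarrow> nat list \<Rightarrow> bool" where
  "cycle T p \<longleftrightarrow> length p \<ge> 3 \<and> distinct p \<and>
     (\<forall>m. Suc m < length p \<longrightarrow> {p ! m, p ! Suc m} \<in> edges T) \<and> {last p, hd p} \<in> edges T"

definition is_tree :: "tree \<Rightarrow> bool" where
  "is_tree T \<longleftrightarrow> finite_simple_graph T \<and> connected_graph T \<and> (\<nexists>p. cycle T p)"

definition trivalent :: "tree \<Rightarrow> bool" where
  "trivalent T \<longleftrightarrow> is_tree T \<and>
     (\<forall>v\<in>verts T. degree T v = 1 \<or> degree T v = 3) \<and> (\<exists>v\<in>verts T. degree T v = 3)"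

definition labeled_trees :: "nat \<Rightarrow> tree set" where
  "labeled_trees n = {T. trivalent T \<and> bij_betw (label T) (leaves T) (labels n)}"

definition isomorphic :: "tree \<Rightarrow> tree \<Rightarrow> bool" where
  "isomorphic S T \<longleftrightarrow> (\<exists>f. bij_betw f (verts S) (verts T) \<and> (\<lambda>e. f ` e) ` edges S = edges T \<and>
     (\<forall>v\<in>leaves S. label T (f v) = label S v))"

definition tree_iso :: "nat \<Rightarrow> (tree \<times> tree) set" where
  "tree_iso n = {(S, T). S \<in> labeled_trees n \<and> T \<in> labeled_trees n \<and> isomorphic S T}"


subsection \<open>The lazy tournament\<close>

text \<open>Edge labelings are partial: \<open>None\<close> marks an edge that has not been labeled yet.\<close>

type_synonym edge_labeling = "nat set \<Rightarrow> int option"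

definition leaf_edge_labeling :: "tree \<Rightarrow> edge_labeling" where
  "leaf_edge_labeling T e =
     (if e \<in> edges T \<and> (\<exists>x\<in>leaves T. x \<in> e)
      then Some (label T (THE x. x \<in> leaves T \<and> x \<in> e)) else None)"

text \<open>
  The edges at \<open>v\<close> are \<open>e\<close>, \<open>f\<close> and \<open>g\<close>, of which \<open>e\<close> carries \<open>i\<close>, \<open>f\<close> carries \<open>j\<close>, and \<open>g\<close> is
  unlabeled; the three are distinct since their labels are.
\<close>

definition can_compete ::
  "tree \<Rightarrow> edge_labeling \<Rightarrow> nat \<Rightarrow> nat set \<Rightarrow> nat set \<Rightarrow> nat set \<Rightarrow> int \<Rightarrow> int \<Rightarrow> bool" where
  "can_compete T L v e f g i j \<longleftrightarrow> v \<in> verts T \<and> incident T v = {e, f, g} \<and>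
     L e = Some i \<and> L f = Some j \<and> i < j \<and> L g = None"

definition face_off ::
  "tree \<Rightarrow> edge_labeling \<Rightarrow> nat \<Rightarrow> nat set \<Rightarrow> nat set \<Rightarrow> nat set \<Rightarrow> int \<Rightarrow> int \<Rightarrow> bool" where
  "face_off T L v e f g i j \<longleftrightarrow> can_compete T L v e f g i j \<and>
     (\<forall>v' e' f' g' i' j'. can_compete T L v' e' f' g' i' j' \<longrightarrow> i' \<le> i)"

definition advancing :: "tree \<Rightarrow> edge_labeling \<Rightarrow> nat set \<Rightarrow> int \<Rightarrow> int \<Rightarrow> int" where
  "advancing T L g i j =
     (if \<exists>h\<in>edges T. h \<noteq> g \<and> h \<inter> g \<noteq> {} \<and> (\<exists>u. L h = Some u \<and> u \<noteq> j \<and> u > i) then i else j)"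

text \<open>
  The list records the pairs \<open>(i, j)\<close>, \<open>i < j\<close>, that have faced off so far, in order: \<open>i\<close> lost the
  round and \<open>j\<close> won it, whichever of the two advances.
\<close>

inductive lazy_rounds :: "tree \<Rightarrow> edge_labeling \<Rightarrow> (int \<times> int) list \<Rightarrow> bool" for T where
  start: "lazy_rounds T (leaf_edge_labeling T) []"
| round: "lazy_rounds T L rs \<Longrightarrow> face_off T L v e f g i j \<Longrightarrow>
    lazy_rounds T (L(g \<mapsto> advancing T L g i j)) (rs @ [(i, j)])"

definition lazy_tournament :: "tree \<Rightarrow> edge_labeling \<Rightarrow> (int \<times> int) list \<Rightarrow> bool" where
  "lazy_tournament T L rs \<longleftrightarrow> lazy_rounds T L rs \<and> (\<forall>e\<in>edges T. L e \<noteq> None)"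

definition rounds_won :: "(int \<times> int) list \<Rightarrow> int \<Rightarrow> nat" where
  "rounds_won rs m = count_list (map snd rs) m"


subsection \<open>The sets Tour\<close>

text \<open>
  On a leaf-labeled trivalent tree the tournament is deterministic and always completes: a label
  occupies a path of edges starting at its leaf, and only the last edge of that path can still
  compete, so the pair with the largest \<open>i\<close> is unique. Hence the existential quantifier over
  \<open>rs\<close> below speaks about the one tournament of \<open>T\<close>.
\<close>

definition tour_trees :: "nat list \<Rightarrow> tree set" where
  "tour_trees k = {T \<in> labeled_trees (length k).
     (\<exists>v x y. x \<in> leaves T \<and> label T x = label_a \<and> y \<in> leaves T \<and> label T y = label_b \<and>
        {x, v} \<in> edges T \<and> {y, v} \<in> edges T) \<and>
     (\<exists>L rs. lazy_tournament T L rs \<and>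
        (\<forall>m\<in>{1..int (length k)}. rounds_won rs m = entry k m))}"

text \<open>
  Elements are isomorphism classes. For the empty composition no rounds are played, and the only
  class is that of the tree with leaves \<open>a, b, c\<close>.
\<close>

definition Tour :: "nat list \<Rightarrow> tree set set" where
  "Tour k = tour_trees k // tree_iso (length k)"


subsection \<open>The map\<close>

definition first_face_off :: "tree \<Rightarrow> nat \<times> nat set \<times> nat set \<times> int \<times> int" where
  "first_face_off T = (THE (v, e, f, i, j). \<exists>g. face_off T (leaf_edge_labeling T) v e f g i j)"

definition decrease_above :: "int \<Rightarrow> int \<Rightarrow> int" where
  "decrease_above m l = (if l > m then l - 1 else l)"

text \<open>The first component is the index \<open>j\<close> of the summand that the resulting tree belongs to.\<close>

definition pi_lazy_tree :: "nat list \<Rightarrow> tree \<Rightarrow> int \<times> tree" where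
  "pi_lazy_tree k T =
     (case first_face_off T of (v, e, f, i, j) \<Rightarrow>
        (j, \<lparr>verts = verts T - {x \<in> leaves T. label T x = i \<or> label T x = j},
             edges = edges T - {e, f},
             label = (if entry k j > 1 then decrease_above i \<circ> (label T)(v := j)
                      else decrease_above j \<circ> (label T)(v := i))\<rparr>))"

text \<open>
  On an isomorphism class the map is given by the common value for all representatives.
\<close>

definition pi_lazy :: "nat list \<Rightarrow> tree set \<Rightarrow> int \<times> tree set" where
  "pi_lazy k C = the_elem
     ((\<lambda>T. case pi_lazy_tree k T of (j, S) \<Rightarrow> (j, tree_iso (length k - 1) `` {S})) ` C)"

end

theory Submission imports Defs begin

text \<open>
  Let \<open>(i, j)\<close> be the pair that faces off first in \<open>T\<close>, at the vertex \<open>v\<close>, and let \<open>S\<close> be \<open>T\<close>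
  without the leaves \<open>i\<close> and \<open>j\<close>, with \<open>v\<close> labeled by whichever of the two advances and the
  labels above the other one, \<open>m\<close>, moved down by one. After the first round the tournament of
  \<open>T\<close> sees only the edges of \<open>S\<close>, with the labels that \<open>S\<close> starts with up to an
  order-preserving renumbering. Hence the tournament of \<open>S\<close> is that of \<open>T\<close> without its first
  round (\<open>lazy_tournament_T_to_S\<close>, \<open>lazy_tournament_S_to_T\<close>), and the numbers of wins of \<open>S\<close>
  arise from \<open>k\<close> by taking one win from \<open>j\<close> and deleting position \<open>m\<close>, which is then zero (for
  \<open>n \<ge> 2\<close> the label \<open>m\<close> turns out to be at least 1).

  The map \<open>pi_lazy\<close> chooses the label to keep by the value of \<open>k\<^sub>j\<close>, and its target is
  described by the rightmost zero of \<open>k\<close>. The heart of the proof is that these agree with the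
  tournament (\<open>first_face_off_of_tour\<close>): \<open>i\<close> is the rightmost zero of \<open>k\<close>, and for \<open>n \<ge> 2\<close> the
  winner \<open>j\<close> advances if and only if \<open>k\<^sub>j > 1\<close>. This goes by induction on \<open>n\<close>, passing from
  \<open>T\<close> to \<open>S\<close>. The cherries (pairs of leaf edges with a common vertex) of \<open>T\<close> and \<open>S\<close> differ
  only near \<open>v\<close>. If \<open>j\<close> advances, laziness says that no leaf that shares its neighbour with
  the new leaf of \<open>S\<close> exceeds \<open>i\<close>, so the first loser of \<open>S\<close> is smaller than \<open>i\<close>
  (\<open>first_loser_S_winner_advances\<close>); by induction the wins of \<open>S\<close> have no zero from position
  \<open>i\<close> on, and the win taken from \<open>j\<close> was not its only one. If \<open>i\<close> advances, it stands next to
  a larger label, so it is the first loser of \<open>S\<close> again (\<open>first_loser_S_loser_advances\<close>); \<open>j\<close>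
  is gone, so \<open>k\<^sub>j = 1\<close>, and the rightmost zero has not moved. The cherry of \<open>a\<close> and \<open>b\<close> never
  interferes, because the far end of a longest path gives another cherry (\<open>far_cherry\<close>), whose
  labels are at least \<open>c\<close>. For \<open>n = 1\<close> no round is left in \<open>S\<close>, and it is immaterial which
  label is kept.

  Injectivity follows because an isomorphism of pruned trees extends over the cherries
  (\<open>isomorphic_graft_cherries\<close>). For surjectivity a cherry with labels \<open>i\<close> and \<open>j\<close> is grafted
  onto \<open>S\<close>, and the comparison of cherries read backwards shows that this cherry faces off
  first and that the required label advances (\<open>first_face_off_T\<close>).
\<close>

section \<open>Trivalent trees\<close>

lemma edge_endpoints:
  assumes "finite_simple_graph T" "{u, w} \<in> edges T"
  shows "u \<in> verts T" "w \<in> verts T" "u \<noteq> w"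
proof -
  obtain p q where "p \<in> verts T" "q \<in> verts T" "p \<noteq> q" "{u, w} = {p, q}"
    using assms unfolding finite_simple_graph_def by blast
  then show "u \<in> verts T" "w \<in> verts T" "u \<noteq> w"
    by (auto simp: doubleton_eq_iff)
qed

lemma edge_through:
  assumes "finite_simple_graph T" "e \<in> edges T" "v \<in> e"
  obtains w where "w \<in> verts T" "w \<noteq> v" "e = {v, w}"
proof -
  obtain p q where pq: "p \<in> verts T" "q \<in> verts T" "p \<noteq> q" "e = {p, q}"
    using assms(1,2) unfolding finite_simple_graph_def by blast
  then have "v = p \<or> v = q" using assms(3) by blast
  then show thesis
    using that[of p] that[of q] pq by (metis insert_commute)
qed

lemma finite_edges:
  assumes "finite_simple_graph T"
  shows "finite (edges T)"
proof (rule finite_subset)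
  show "edges T \<subseteq> Pow (verts T)"
    using assms unfolding finite_simple_graph_def by fastforce
  show "finite (Pow (verts T))"
    using assms by (simp add: finite_simple_graph_def)
qed

lemma finite_incident: "finite_simple_graph T \<Longrightarrow> finite (incident T v)"
  using finite_edges by (simp add: incident_def)

lemma trivalentD:
  assumes "trivalent T"
  shows "finite_simple_graph T" "connected_graph T" "\<nexists>p. cycle T p"
    "v \<in> verts T \<Longrightarrow> degree T v = 1 \<or> degree T v = 3" "\<exists>v\<in>verts T. degree T v = 3"
  using assms by (auto simp: trivalent_def is_tree_def)

lemma connected_closed_set:
  assumes "connected_graph T" "u \<in> A" "u \<in> verts T"
    and "\<And>p q. p \<in> A \<Longrightarrow> {p, q} \<in> edges T \<Longrightarrow> q \<in> A"
  shows "verts T \<subseteq> A"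
proof
  fix w assume "w \<in> verts T"
  then have "(u, w) \<in> {(x, y). {x, y} \<in> edges T}\<^sup>*"
    using assms(1,3) by (auto simp: connected_graph_def)
  then show "w \<in> A"
    by induction (use assms in auto)
qed

lemma leaf_edge_unique:
  assumes "x \<in> leaves T" "e \<in> edges T" "e' \<in> edges T" "x \<in> e" "x \<in> e'"
  shows "e = e'"
proof -
  from assms(1) obtain d where "incident T x = {d}"
    by (auto simp: leaves_def degree_def card_1_singleton_iff)
  moreover have "e \<in> incident T x" "e' \<in> incident T x"
    using assms by (simp_all add: incident_def)
  ultimately show ?thesis by simp
qed

lemma leaf_edge_exists:
  assumes "finite_simple_graph T" "x \<in> leaves T"
  obtains w where "{x, w} \<in> edges T"
proof -
  from assms(2) obtain d where "incident T x = {d}"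
    by (auto simp: leaves_def degree_def card_1_singleton_iff)
  then have "d \<in> incident T x" by simp
  then have "d \<in> edges T" "x \<in> d"
    by (simp_all add: incident_def)
  then show thesis
    using edge_through[OF assms(1)] that by metis
qed

lemma leaf_neighbour_unique:
  assumes "finite_simple_graph T" "x \<in> leaves T" "{u, x} \<in> edges T" "{w, x} \<in> edges T"
  shows "u = w"
  using leaf_edge_unique[OF assms(2-4)] by (auto simp: doubleton_eq_iff)

text \<open>
  Two adjacent leaves would form a component of their own, leaving no room for a vertex of
  degree 3.
\<close>
lemma leaf_neighbour_inner:
  assumes "trivalent T" "x \<in> leaves T" "{w, x} \<in> edges T"
  shows "w \<notin> leaves T"
proof
  assume w: "w \<in> leaves T"
  note T = trivalentD[OF assms(1)]
  have "verts T \<subseteq> {x, w}"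
  proof (rule connected_closed_set[OF T(2)])
    show "x \<in> {x, w}" "x \<in> verts T"
      using assms(2) by (auto simp: leaves_def)
    fix p q assume "p \<in> {x, w}" "{p, q} \<in> edges T"
    then have "{p, q} = {w, x}"
      using leaf_edge_unique[OF w] leaf_edge_unique[OF assms(2)] assms(3) by blast
    then show "q \<in> {x, w}" by auto
  qed
  moreover have "degree T x = 1" "degree T w = 1"
    using assms(2) w by (auto simp: leaves_def)
  ultimately show False
    using T(5) by force
qed

lemma inner_degree:
  assumes "trivalent T" "v \<in> verts T" "v \<notin> leaves T"
  shows "card (incident T v) = 3"
  using trivalentD(4)[OF assms(1,2)] assms(2,3) by (auto simp: leaves_def degree_def)

section \<open>The state before the first round\<close>

text \<open>
  An edge contains at most one leaf, so the definite description in the initial labeling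
  denotes it.
\<close>
lemma leaf_edge_labeling_leaf:
  assumes "trivalent T" "x \<in> leaves T" "e \<in> edges T" "x \<in> e"
  shows "leaf_edge_labeling T e = Some (label T x)"
proof -
  have "y = x" if y: "y \<in> leaves T" "y \<in> e" for y
  proof (rule ccontr)
    assume "y \<noteq> x"
    then have "e = {y, x}"
      using edge_through[OF trivalentD(1)[OF assms(1)] assms(3) y(2)] assms(4) by blast
    then show False
      using leaf_neighbour_inner[OF assms(1,2)] assms(3) y(1) by blast
  qed
  then have "(THE y. y \<in> leaves T \<and> y \<in> e) = x"
    using assms by blast
  then show ?thesis
    using assms by (auto simp: leaf_edge_labeling_def)
qed

lemma leaf_edge_labeling_eq_None_iff:
  "leaf_edge_labeling T e = None \<longleftrightarrow> e \<notin> edges T \<or> (\<forall>x\<in>leaves T. x \<notin> e)"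
  by (auto simp: leaf_edge_labeling_def)

lemma leaf_edge_labeling_SomeE:
  assumes "trivalent T" "leaf_edge_labeling T e = Some l"
  obtains x where "x \<in> leaves T" "x \<in> e" "e \<in> edges T" "label T x = l"
proof -
  have "e \<in> edges T" "\<exists>x\<in>leaves T. x \<in> e"
    using assms(2) by (auto simp: leaf_edge_labeling_def split: if_splits)
  then show thesis
    using leaf_edge_labeling_leaf[OF assms(1)] assms(2) that by auto
qed

text \<open>
  Before the first round the competing edges are the two leaf edges of a cherry whose third
  edge leads to an inner vertex.
\<close>
lemma initial_competitors:
  assumes "trivalent T" "can_compete T (leaf_edge_labeling T) v e f g i j"
  obtains x y w where "x \<in> leaves T" "y \<in> leaves T" "x \<noteq> y" "e = {v, x}" "f = {v, y}" "g = {v, w}"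
    "e \<in> edges T" "f \<in> edges T" "g \<in> edges T" "v \<in> verts T" "w \<in> verts T" "v \<notin> leaves T" "w \<notin> leaves T"
    "w \<noteq> v" "label T x = i" "label T y = j"
proof -
  have inc: "incident T v = {e, f, g}" "v \<in> verts T" "leaf_edge_labeling T e = Some i"
    "leaf_edge_labeling T f = Some j" "i < j" "leaf_edge_labeling T g = None"
    using assms(2) by (auto simp: can_compete_def)
  have "e \<in> incident T v" "f \<in> incident T v" "g \<in> incident T v"
    unfolding inc(1) by simp_all
  then have mem: "e \<in> edges T" "v \<in> e" "f \<in> edges T" "v \<in> f" "g \<in> edges T" "v \<in> g"
    by (simp_all add: incident_def)
  have v: "v \<notin> leaves T"
    using mem(5,6) inc(6) by (auto simp: leaf_edge_labeling_eq_None_iff)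
  obtain x where x: "x \<in> leaves T" "x \<in> e" "label T x = i"
    using leaf_edge_labeling_SomeE[OF assms(1) inc(3)] by metis
  obtain y where y: "y \<in> leaves T" "y \<in> f" "label T y = j"
    using leaf_edge_labeling_SomeE[OF assms(1) inc(4)] by metis
  note through = edge_through[OF trivalentD(1)[OF assms(1)]]
  obtain w where w: "w \<in> verts T" "w \<noteq> v" "g = {v, w}"
    using through[OF mem(5,6)] by metis
  have "e = {v, x}"
  proof -
    obtain u where "e = {v, u}" using through[OF mem(1,2)] by metis
    then show ?thesis using x(1,2) v by auto
  qed
  moreover have "f = {v, y}"
  proof -
    obtain u where "f = {v, u}" using through[OF mem(3,4)] by metis
    then show ?thesis using y(1,2) v by auto
  qed
  moreover have "w \<notin> leaves T"
    using inc(6) mem(5) w(3) by (auto simp: leaf_edge_labeling_eq_None_iff)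
  moreover have "x \<noteq> y"
    using x(3) y(3) inc(5) by auto
  ultimately show thesis
    using that[of x y w] x(1,3) y(1,3) w v mem(1,3,5) inc(2) by blast
qed

lemma inner_incident_eq:
  assumes "trivalent T" "v \<in> verts T" "v \<notin> leaves T"
    "e \<in> incident T v" "f \<in> incident T v" "g \<in> incident T v" "e \<noteq> f" "e \<noteq> g" "f \<noteq> g"
  shows "incident T v = {e, f, g}"
proof -
  have "card {e, f, g} = 3" using assms by simp
  then show ?thesis
    using card_subset_eq[of "incident T v" "{e, f, g}"] inner_degree[OF assms(1-3)] assms(4-6)
      finite_incident[OF trivalentD(1)[OF assms(1)]] by auto
qed

lemma cherry_can_compete:
  assumes "trivalent T" "x \<in> leaves T" "y \<in> leaves T" "{v, x} \<in> edges T" "{v, y} \<in> edges T"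
    "label T x < label T y" "{v, w} \<in> edges T" "w \<notin> leaves T"
  shows "can_compete T (leaf_edge_labeling T) v {v, x} {v, y} {v, w} (label T x) (label T y)"
proof -
  have v: "v \<in> verts T" "v \<notin> leaves T"
    using edge_endpoints[OF trivalentD(1)[OF assms(1)] assms(4)] leaf_neighbour_inner[OF assms(1,2,4)]
    by auto
  have "incident T v = {{v, x}, {v, y}, {v, w}}"
    by (rule inner_incident_eq[OF assms(1) v])
      (use assms in \<open>auto simp: incident_def doubleton_eq_iff\<close>)
  moreover have "leaf_edge_labeling T {v, w} = None"
    using v assms(8) by (auto simp: leaf_edge_labeling_eq_None_iff)
  ultimately show ?thesis
    using assms(6) v leaf_edge_labeling_leaf[OF assms(1,2,4)] leaf_edge_labeling_leaf[OF assms(1,3,5)]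
    by (auto simp: can_compete_def)
qed

lemma labels_eq: "labels n = {-2..int n}"
  by (auto simp: labels_def)

lemma labeled_treesD:
  assumes "T \<in> labeled_trees n"
  shows "trivalent T" "inj_on (label T) (leaves T)" "label T ` leaves T = {-2..int n}"
    "x \<in> leaves T \<Longrightarrow> label T x \<in> {-2..int n}" "card (leaves T) = n + 3"
proof -
  show *: "trivalent T" "inj_on (label T) (leaves T)" "label T ` leaves T = {-2..int n}"
    using assms by (auto simp: labeled_trees_def bij_betw_def labels_eq)
  show "x \<in> leaves T \<Longrightarrow> label T x \<in> {-2..int n}" using *(3) by blast
  show "card (leaves T) = n + 3"
    using card_image[OF *(2)] *(3) by simp
qed

text \<open>
  A leaf label determines its leaf, the leaf its edge, and the edge the vertex of the cherry.
  So the largest possible loser determines all of the first face-off.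
\<close>
lemma initial_face_off_unique:
  assumes "trivalent T" "inj_on (label T) (leaves T)"
    "face_off T (leaf_edge_labeling T) v e f g i j" "face_off T (leaf_edge_labeling T) v' e' f' g' i' j'"
  shows "v = v'" "e = e'" "f = f'" "g = g'" "i = i'" "j = j'"
proof -
  have c: "can_compete T (leaf_edge_labeling T) v e f g i j"
    "can_compete T (leaf_edge_labeling T) v' e' f' g' i' j'"
    using assms(3,4) by (auto simp: face_off_def)
  show i: "i = i'"
    using assms(3,4) unfolding face_off_def by (meson order_antisym)
  obtain x y w where x: "x \<in> leaves T" "e = {v, x}" "e \<in> edges T" "label T x = i" "v \<notin> leaves T"
    using initial_competitors[OF assms(1) c(1)] by metis
  obtain x' y' w' where x': "x' \<in> leaves T" "e' = {v', x'}" "e' \<in> edges T" "label T x' = i'"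
      "v' \<notin> leaves T"
    using initial_competitors[OF assms(1) c(2)] by metis
  have "x = x'"
    using assms(2) i x x' by (auto dest: inj_onD)
  then show e: "e = e'"
    using leaf_edge_unique[OF x(1,3) x'(3)] x(2) x'(2) by auto
  then show v: "v = v'"
    using x x' \<open>x = x'\<close> by (auto simp: doubleton_eq_iff)
  show "f = f'" "g = g'" "j = j'"
  proof -
    let ?L = "leaf_edge_labeling T"
    have eq: "{e, f, g} = {e, f', g'}"
      using c e v by (simp add: can_compete_def)
    have L: "?L e = Some i" "?L f = Some j" "?L g = None" "?L f' = Some j'" "?L g' = None" "i < j"
      "i < j'"
      using c e i by (simp_all add: can_compete_def)
    have "f \<in> {e, f', g'}" "g \<in> {e, f', g'}"
      using eq by blast+
    then show "f = f'" "g = g'" using L by auto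
    then show "j = j'" using L by simp
  qed
qed

lemma first_face_off_eq:
  assumes "trivalent T" "inj_on (label T) (leaves T)"
    "face_off T (leaf_edge_labeling T) v e f g i j"
  shows "first_face_off T = (v, e, f, i, j)"
  unfolding first_face_off_def
proof (rule the_equality)
  show "case (v, e, f, i, j) of (v, e, f, i, j) \<Rightarrow>
      \<exists>g. face_off T (leaf_edge_labeling T) v e f g i j"
    using assms(3) by auto
next
  fix r assume "case r of (v, e, f, i, j) \<Rightarrow> \<exists>g. face_off T (leaf_edge_labeling T) v e f g i j"
  then show "r = (v, e, f, i, j)"
    using initial_face_off_unique[OF assms] by (cases r) (simp, metis)
qed

section \<open>Stars and far cherries\<close>

text \<open>
  A leaf next to \<open>v\<close> has no other neighbour, so \<open>v\<close> and its neighbours are closed under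
  adjacency.
\<close>
lemma star_verts:
  assumes "trivalent T" "v \<in> verts T" "\<And>w. {v, w} \<in> edges T \<Longrightarrow> w \<in> leaves T"
  shows "verts T \<subseteq> insert v {w. {v, w} \<in> edges T}"
proof (rule connected_closed_set[OF trivalentD(2)[OF assms(1)] _ assms(2)])
  fix p q assume p: "p \<in> insert v {w. {v, w} \<in> edges T}" and pq: "{p, q} \<in> edges T"
  show "q \<in> insert v {w. {v, w} \<in> edges T}"
  proof (cases "p = v")
    case False
    then have "{v, p} \<in> edges T" using p by auto
    then have "{v, p} = {p, q}"
      using leaf_edge_unique[of p T] assms(3) pq by blast
    then show ?thesis by (auto simp: doubleton_eq_iff)
  qed (use pq in auto)
qed auto

text \<open>
  A star has three leaves, and these are used up by \<open>a\<close>, \<open>b\<close> and \<open>c\<close>. For \<open>n \<ge> 1\<close> every inner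
  vertex therefore has an inner neighbour.
\<close>
lemma star_no_numbered_leaf:
  assumes "T \<in> labeled_trees n" "v \<in> verts T" "v \<notin> leaves T"
    "\<And>w. {v, w} \<in> edges T \<Longrightarrow> w \<in> leaves T"
  shows "n = 0"
proof -
  note T = labeled_treesD[OF assms(1)]
  have "leaves T \<subseteq> {w. {v, w} \<in> edges T}"
    using star_verts[OF T(1) assms(2,4)] assms(3) by (auto simp: leaves_def)
  moreover have "inj_on (\<lambda>w. {v, w}) {w. {v, w} \<in> edges T}"
    by (auto simp: inj_on_def doubleton_eq_iff)
  moreover have "(\<lambda>w. {v, w}) ` {w. {v, w} \<in> edges T} \<subseteq> incident T v"
    by (auto simp: incident_def)
  ultimately have "card (leaves T) \<le> card (incident T v)"
    using finite_incident[OF trivalentD(1)[OF T(1)]]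
    by (meson card_inj_on_le inj_on_subset image_mono subset_trans)
  then show ?thesis
    using T(5) inner_degree[OF T(1) assms(2,3)] by simp
qed

lemma inner_third_neighbour:
  assumes "trivalent T" "v \<in> verts T" "v \<notin> leaves T"
  obtains w where "{v, w} \<in> edges T" "w \<noteq> p" "w \<noteq> q"
proof -
  have "card {{v, p}, {v, q}} < card (incident T v)"
    using inner_degree[OF assms] card_insert_le_m1[of 2 "{{v, q}}" "{v, p}"] by simp
  then have "\<not> incident T v \<subseteq> {{v, p}, {v, q}}"
    using card_mono[of "{{v, p}, {v, q}}" "incident T v"] by auto
  then obtain e where "e \<in> edges T" "v \<in> e" "e \<noteq> {v, p}" "e \<noteq> {v, q}"
    by (auto simp: incident_def)
  then show thesis
    using edge_through[OF trivalentD(1)[OF assms(1)]] that by metis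
qed

text \<open>Any other neighbour on the path would close a cycle with the initial segment leading to it.\<close>
lemma path_head_chord:
  assumes "\<nexists>p. cycle T p" "distinct (z # p)" "successively (\<lambda>u w. {u, w} \<in> edges T) (z # p)"
    "q \<in> set p" "{z, q} \<in> edges T"
  shows "q = hd p"
proof (rule ccontr)
  assume "q \<noteq> hd p"
  obtain r s where p: "p = r @ q # s"
    using assms(4) by (meson split_list)
  have "r \<noteq> []"
    using \<open>q \<noteq> hd p\<close> p by auto
  have "successively (\<lambda>u w. {u, w} \<in> edges T) ((z # r @ [q]) @ s)"
    using assms(3) p by simp
  then have "successively (\<lambda>u w. {u, w} \<in> edges T) (z # r @ [q])"
    unfolding successively_append_iff by blast
  then have "cycle T (z # r @ [q])"
    using \<open>r \<noteq> []\<close> assms(2,5) p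
    by (auto simp: cycle_def successively_conv_nth insert_commute Suc_le_eq)
  then show False
    using assms(1) by blast
qed

text \<open>
  Take the penultimate vertex of a longest path that starts at \<open>v\<close>. Its two neighbours other
  than its predecessor can both serve as the last vertex of a longest path, and hence are
  leaves.
\<close>
lemma far_cherry:
  assumes T: "trivalent T" and v: "v \<in> verts T" "v \<notin> leaves T"
    and z: "{v, z} \<in> edges T" "z \<notin> leaves T"
  obtains u x y w where "u \<noteq> v" "x \<noteq> y" "x \<in> leaves T" "y \<in> leaves T"
    "{u, x} \<in> edges T" "{u, y} \<in> edges T" "{u, w} \<in> edges T" "w \<notin> leaves T"
proof -
  let ?succ = "successively (\<lambda>u w. {u, w} \<in> edges T)"
  define path where "path p \<longleftrightarrow> p \<noteq> [] \<and> distinct p \<and> set p \<subseteq> verts T \<and> last p = v \<and> ?succ p" for p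
  note G = trivalentD(1)[OF T] and acyclic = trivalentD(3)[OF T]
  note ends = edge_endpoints[OF G]
  \<comment> \<open>A path with three vertices: it keeps the penultimate vertex of a longest path away from \<open>v\<close>.\<close>
  obtain z' where z': "{z, z'} \<in> edges T" "z' \<noteq> v"
    using inner_third_neighbour[OF T, of z v v] ends(2)[OF z(1)] z(2) by metis
  have "path [z', z, v]"
    using z z' v ends[OF z(1)] ends[OF z'(1)] by (auto simp: path_def insert_commute)
  moreover have "length p < Suc (card (verts T))" if "path p" for p
    using that card_mono[of "verts T" "set p"] G
    by (auto simp: path_def finite_simple_graph_def distinct_card)
  ultimately obtain p where p: "path p" "\<And>q. path q \<Longrightarrow> length q \<le> length p"
    using ex_has_greatest_nat[of path "[z', z, v]" length "Suc (card (verts T))"] by (metis less_imp_le_nat)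
  \<comment> \<open>A longest path cannot be extended, so all neighbours of its end lie on it.\<close>
  have end_leaf: "s \<in> leaves T" if s: "path (s # t # r)" "length (s # t # r) = length p" for s t r
  proof -
    have "q = t" if q: "{s, q} \<in> edges T" for q
    proof -
      have "\<not> path (q # s # t # r)"
        using p(2)[of "q # s # t # r"] s(2) by auto
      then have "q \<in> set (s # t # r)"
        using s(1) q ends[OF q] by (auto simp: path_def insert_commute)
      then show "q = t"
        using path_head_chord[OF acyclic, of s "t # r" q] s(1) q ends[OF q] by (auto simp: path_def)
    qed
    then show ?thesis
      using inner_third_neighbour[OF T, of s t t] s(1) by (auto simp: path_def)
  qed
  have "length p \<ge> 3"
    using p(2)[OF \<open>path [z', z, v]\<close>] by simp
  then obtain x u w r where pr: "p = x # u # w # r"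
    by (metis One_nat_def Suc_le_length_iff numeral_3_eq_3)
  have x: "x \<in> leaves T"
    using end_leaf p(1) pr by blast
  have path_u: "distinct (u # w # r)" "?succ (u # w # r)" "{u, x} \<in> edges T" "u \<in> verts T"
    "last (w # r) = v" "{u, w} \<in> edges T" "x \<noteq> w"
    using p(1) pr by (auto simp: path_def insert_commute)
  have "u \<noteq> v"
    using path_u(1,5) last_in_set[of "w # r"] by auto
  have u: "u \<notin> leaves T"
    using leaf_neighbour_inner[OF T x path_u(3)] .
  obtain y where y: "{u, y} \<in> edges T" "y \<noteq> x" "y \<noteq> w"
    using inner_third_neighbour[OF T path_u(4) u] by metis
  \<comment> \<open>Replacing \<open>x\<close> by \<open>y\<close> gives another longest path, with \<open>y\<close> as its end.\<close>
  have "y \<notin> set (u # w # r)"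
    using path_head_chord[OF acyclic path_u(1,2), of y] y ends[OF y(1)] by auto
  then have "path (y # u # w # r)"
    using p(1) pr y ends[OF y(1)] by (auto simp: path_def insert_commute)
  then have "y \<in> leaves T"
    using end_leaf pr by simp
  moreover have "w \<notin> leaves T"
  proof (cases r)
    case Nil
    then show ?thesis using path_u(5) v by simp
  next
    case (Cons s t)
    then have "{s, w} \<in> edges T" "s \<noteq> u"
      using path_u(1,2) by (auto simp: insert_commute)
    then show ?thesis
      using leaf_neighbour_unique[OF G _ path_u(6)] by blast
  qed
  ultimately show thesis
    using that[of u x y w] \<open>u \<noteq> v\<close> x y(1,2) path_u(3,6) by blast
qed

section \<open>Grafting and pruning cherries\<close>

definition grafted :: "tree \<Rightarrow> tree \<Rightarrow> nat \<Rightarrow> nat \<Rightarrow> nat \<Rightarrow> bool" where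
  "grafted S T v x y \<longleftrightarrow> v \<in> leaves S \<and> x \<notin> verts S \<and> y \<notin> verts S \<and> x \<noteq> y \<and>
     verts T = verts S \<union> {x, y} \<and> edges T = edges S \<union> {{v, x}, {v, y}}"

text \<open>This keeps leaves off cycles.\<close>
lemma cycle_two_neighbours:
  assumes "cycle T p" "z \<in> set p"
  obtains u w where "u \<in> set p" "w \<in> set p" "u \<noteq> w" "{u, z} \<in> edges T" "{w, z} \<in> edges T"
proof -
  have p: "length p \<ge> 3" "distinct p" "\<And>m. Suc m < length p \<Longrightarrow> {p ! m, p ! Suc m} \<in> edges T"
    "{last p, hd p} \<in> edges T" "p \<noteq> []"
    using assms(1) by (auto simp: cycle_def)
  obtain m where m: "m < length p" "z = p ! m"
    using assms(2) by (metis in_set_conv_nth)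
  define l where "l = length p"
  have hl: "hd p = p ! 0" "last p = p ! (l - 1)"
    using p(5) by (simp_all add: hd_conv_nth last_conv_nth l_def)
  \<comment> \<open>The successor and the predecessor of \<open>m\<close> in cyclic order.\<close>
  define s where "s = (if Suc m < l then Suc m else 0)"
  define t where "t = (if m = 0 then l - 1 else m - 1)"
  have "s < l" "t < l" "s \<noteq> t"
    using p(1) m(1) by (auto simp: s_def t_def l_def)
  moreover have "{p ! s, z} \<in> edges T"
  proof (cases "Suc m < l")
    case True
    then show ?thesis using p(3)[of m] m by (simp add: s_def l_def insert_commute)
  next
    case False
    then have "m = l - 1" using m(1) by (simp add: l_def)
    then show ?thesis using p(4) hl m(2) False by (simp add: s_def insert_commute)
  qed
  moreover have "{p ! t, z} \<in> edges T"
    using p(3)[of "m - 1"] p(4) hl m by (auto simp: t_def l_def insert_commute)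
  ultimately show thesis
    using that[of "p ! s" "p ! t"] p(2) by (auto simp: l_def nth_eq_iff_index_eq)
qed

lemma grafted_incident:
  assumes "grafted S T v x y" "finite_simple_graph S"
  shows "u \<noteq> v \<Longrightarrow> u \<noteq> x \<Longrightarrow> u \<noteq> y \<Longrightarrow> incident T u = incident S u"
    "incident T v = incident S v \<union> {{v, x}, {v, y}}"
    "incident T x = {{v, x}}" "incident T y = {{v, y}}"
    "{v, x} \<notin> edges S" "{v, y} \<notin> edges S" "v \<noteq> x" "v \<noteq> y" "{v, x} \<noteq> {v, y}"
proof -
  have g: "v \<in> verts S" "x \<notin> verts S" "y \<notin> verts S" "x \<noteq> y" "edges T = edges S \<union> {{v, x}, {v, y}}"
    using assms(1) by (auto simp: grafted_def leaves_def)
  have sub: "e \<subseteq> verts S" if "e \<in> edges S" for e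
    using assms(2) that by (auto simp: finite_simple_graph_def)
  show "v \<noteq> x" "v \<noteq> y" using g by auto
  show "u \<noteq> v \<Longrightarrow> u \<noteq> x \<Longrightarrow> u \<noteq> y \<Longrightarrow> incident T u = incident S u"
    "incident T v = incident S v \<union> {{v, x}, {v, y}}"
    "incident T x = {{v, x}}" "incident T y = {{v, y}}"
    "{v, x} \<notin> edges S" "{v, y} \<notin> edges S" "{v, x} \<noteq> {v, y}"
    using g(1-4) sub unfolding incident_def g(5) by (blast dest: doubleton_eq_iff[THEN iffD1])+
qed

lemma grafted_degree:
  assumes "grafted S T v x y" "finite_simple_graph S"
  shows "u \<noteq> v \<Longrightarrow> u \<noteq> x \<Longrightarrow> u \<noteq> y \<Longrightarrow> degree T u = degree S u"
    "degree T v = 3" "degree T x = 1" "degree T y = 1"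
proof -
  note inc = grafted_incident[OF assms]
  show "u \<noteq> v \<Longrightarrow> u \<noteq> x \<Longrightarrow> u \<noteq> y \<Longrightarrow> degree T u = degree S u" "degree T x = 1" "degree T y = 1"
    using inc(1,3,4) by (simp_all add: degree_def)
  have "{v, x} \<notin> incident S v" "{v, y} \<notin> incident S v"
    using inc(5,6) by (simp_all add: incident_def)
  moreover have "card (incident S v) = 1"
    using assms(1) by (simp add: grafted_def leaves_def degree_def)
  ultimately show "degree T v = 3"
    using inc(2,9) finite_incident[OF assms(2), of v] by (simp add: degree_def)
qed

lemma grafted_leaves:
  assumes "grafted S T v x y" "finite_simple_graph S"
  shows "leaves T = (leaves S - {v}) \<union> {x, y}"
proof -
  have g: "verts T = verts S \<union> {x, y}" "x \<notin> verts S" "y \<notin> verts S" "v \<noteq> x" "v \<noteq> y"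
    using assms(1) by (auto simp: grafted_def leaves_def)
  have "u \<in> leaves T \<longleftrightarrow> u \<in> (leaves S - {v}) \<union> {x, y}" for u
  proof (cases "u = v \<or> u = x \<or> u = y")
    case True
    then show ?thesis using g grafted_degree(2-4)[OF assms] by (auto simp: leaves_def)
  next
    case False
    then show ?thesis using g grafted_degree(1)[OF assms] by (simp add: leaves_def)
  qed
  then show ?thesis by blast
qed

lemma grafted_connected_iff:
  assumes "grafted S T v x y" "finite_simple_graph S"
  shows "connected_graph T \<longleftrightarrow> connected_graph S"
proof -
  let ?S = "{(p, q). {p, q} \<in> edges S}" and ?T = "{(p, q). {p, q} \<in> edges T}"
  have g: "v \<in> verts S" "x \<notin> verts S" "y \<notin> verts S" "x \<noteq> y" "edges T = edges S \<union> {{v, x}, {v, y}}"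
    "verts T = verts S \<union> {x, y}"
    using assms(1) by (auto simp: grafted_def leaves_def)
  \<comment> \<open>Contracting the cherry onto \<open>v\<close> maps walks in \<open>T\<close> to walks in \<open>S\<close>.\<close>
  define r where "r u = (if u = x \<or> u = y then v else u)" for u
  have edge_step: "(r p, r q) \<in> ?S\<^sup>*" if "{p, q} \<in> edges T" for p q
  proof (cases "{p, q} \<in> edges S")
    case True
    then have "p \<in> verts S" "q \<in> verts S"
      using edge_endpoints[OF assms(2)] by auto
    then have "r p = p" "r q = q" using g by (auto simp: r_def)
    then show ?thesis using True by auto
  next
    case False
    then have "r p = v" "r q = v"
      using that g(5) by (auto simp: r_def doubleton_eq_iff)
    then show ?thesis by simp
  qed
  have retract: "(r p, r q) \<in> ?S\<^sup>*" if "(p, q) \<in> ?T\<^sup>*" for p q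
    using that
  proof induction
    case (step q s)
    then show ?case using edge_step[of q s] by (auto intro: rtrancl_trans)
  qed auto
  have mono: "?S\<^sup>* \<subseteq> ?T\<^sup>*"
    using g(5) by (intro rtrancl_mono) auto
  have to_v: "(p, r p) \<in> ?T\<^sup>*" "(r p, p) \<in> ?T\<^sup>*" for p
    using g(5) by (auto simp: r_def insert_commute)
  show ?thesis
  proof
    assume T: "connected_graph T"
    have "(p, q) \<in> ?S\<^sup>*" if "p \<in> verts S" "q \<in> verts S" for p q
    proof -
      have "(p, q) \<in> ?T\<^sup>*" using T that g by (auto simp: connected_graph_def)
      moreover have "r p = p" "r q = q" using that g by (auto simp: r_def)
      ultimately show ?thesis using retract[of p q] by simp
    qed
    then show "connected_graph S" using g by (auto simp: connected_graph_def)
  next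
    assume S: "connected_graph S"
    have "(p, q) \<in> ?T\<^sup>*" if "p \<in> verts T" "q \<in> verts T" for p q
    proof -
      have "r p \<in> verts S" "r q \<in> verts S" using that g by (auto simp: r_def)
      then have "(r p, r q) \<in> ?T\<^sup>*" using S mono by (auto simp: connected_graph_def)
      then show ?thesis using to_v by (meson rtrancl_trans)
    qed
    then show "connected_graph T" using g by (auto simp: connected_graph_def)
  qed
qed

text \<open>The new leaves have one neighbour each, so no cycle passes through them.\<close>
lemma grafted_acyclic_iff:
  assumes "grafted S T v x y" "finite_simple_graph S"
  shows "(\<exists>p. cycle T p) \<longleftrightarrow> (\<exists>p. cycle S p)"
proof
  have g: "edges T = edges S \<union> {{v, x}, {v, y}}"
    using assms(1) by (auto simp: grafted_def)
  show "\<exists>p. cycle S p \<Longrightarrow> \<exists>p. cycle T p"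
    using g unfolding cycle_def by blast
  assume "\<exists>p. cycle T p"
  then obtain p where p: "cycle T p" by blast
  have "u = v" if "{u, x} \<in> edges T \<or> {u, y} \<in> edges T" for u
  proof -
    have "{u, x} \<in> incident T x \<or> {u, y} \<in> incident T y"
      using that by (auto simp: incident_def)
    then show ?thesis
      using grafted_incident(7,8)[OF assms] unfolding grafted_incident(3,4)[OF assms]
      by (auto simp: doubleton_eq_iff)
  qed
  then have "x \<notin> set p" "y \<notin> set p"
    using cycle_two_neighbours[OF p] by metis+
  then have edge: "{s, t} \<in> edges S" if "{s, t} \<in> edges T" "s \<in> set p" "t \<in> set p" for s t
    using that g by (auto simp: doubleton_eq_iff)
  have "p \<noteq> []" using p by (auto simp: cycle_def)
  then have "cycle S p"
    using p edge unfolding cycle_def by (metis Suc_lessD hd_in_set last_in_set nth_mem)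
  then show "\<exists>p. cycle S p" by blast
qed

lemma grafted_trivalent:
  assumes "grafted S T v x y" "trivalent S"
  shows "trivalent T"
proof -
  note S = trivalentD[OF assms(2)]
  have g: "v \<in> verts S" "x \<notin> verts S" "y \<notin> verts S" "x \<noteq> y" "edges T = edges S \<union> {{v, x}, {v, y}}"
    "verts T = verts S \<union> {x, y}"
    using assms(1) by (auto simp: grafted_def leaves_def)
  have "finite_simple_graph T"
    unfolding finite_simple_graph_def
  proof (intro conjI ballI)
    show "finite (verts T)"
      using S(1) g by (simp add: finite_simple_graph_def)
    fix e assume "e \<in> edges T"
    then consider "e \<in> edges S" | "e = {v, x}" | "e = {v, y}" using g by auto
    then show "\<exists>u\<in>verts T. \<exists>w\<in>verts T. u \<noteq> w \<and> e = {u, w}"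
    proof cases
      case 1
      then obtain p q where "p \<in> verts S" "q \<in> verts S" "p \<noteq> q" "e = {p, q}"
        using S(1) unfolding finite_simple_graph_def by blast
      then show ?thesis using g(6) by blast
    qed (use g in auto)
  qed
  moreover have "connected_graph T" "\<nexists>p. cycle T p"
    using S(2,3) grafted_connected_iff[OF assms(1) S(1)] grafted_acyclic_iff[OF assms(1) S(1)] by auto
  moreover have "degree T u = 1 \<or> degree T u = 3" if "u \<in> verts T" for u
  proof (cases "u = v \<or> u = x \<or> u = y")
    case True
    then show ?thesis using grafted_degree[OF assms(1) S(1)] by auto
  next
    case False
    then show ?thesis using that g(6) S(4) grafted_degree(1)[OF assms(1) S(1)] by auto
  qed
  moreover have "\<exists>v\<in>verts T. degree T v = 3"
    using grafted_degree(2)[OF assms(1) S(1)] g by blast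
  ultimately show ?thesis
    by (simp add: trivalent_def is_tree_def)
qed

text \<open>
  The vertex \<open>w\<close> survives with degree 3, so what is left is still a trivalent tree and not a
  single edge.
\<close>
lemma pruned_trivalent:
  assumes T: "trivalent T" and "x \<noteq> y" "x \<in> leaves T" "y \<in> leaves T"
    "{v, x} \<in> edges T" "{v, y} \<in> edges T" "{v, w} \<in> edges T" "w \<notin> leaves T"
    and S: "verts S = verts T - {x, y}" "edges S = edges T - {{v, x}, {v, y}}"
  shows "trivalent S" "grafted S T v x y"
proof -
  note TD = trivalentD[OF T]
  note ends = edge_endpoints[OF TD(1)]
  have v: "v \<in> verts T" "v \<notin> leaves T" "v \<noteq> x" "v \<noteq> y"
    using ends[OF assms(5)] ends[OF assms(6)] leaf_neighbour_inner[OF T assms(3,5)] by auto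
  have w: "w \<in> verts T" "w \<noteq> v" "w \<noteq> x" "w \<noteq> y"
    using ends[OF assms(7)] assms(3,4,8) by auto
  have G: "finite_simple_graph S"
    unfolding finite_simple_graph_def
  proof (intro conjI ballI)
    show "finite (verts S)"
      using TD(1) S by (simp add: finite_simple_graph_def)
    fix e assume e: "e \<in> edges S"
    then have eT: "e \<in> edges T" "e \<noteq> {v, x}" "e \<noteq> {v, y}" using S by simp_all
    then obtain p q where pq: "p \<in> verts T" "q \<in> verts T" "p \<noteq> q" "e = {p, q}"
      using TD(1) unfolding finite_simple_graph_def by blast
    have "x \<notin> e" "y \<notin> e"
      using eT leaf_edge_unique[OF assms(3) eT(1) assms(5)] leaf_edge_unique[OF assms(4) eT(1) assms(6)]
      by blast+
    then show "\<exists>p\<in>verts S. \<exists>q\<in>verts S. p \<noteq> q \<and> e = {p, q}"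
      using pq S by auto
  qed
  have "incident T v = {{v, x}, {v, y}, {v, w}}"
    by (rule inner_incident_eq[OF T v(1,2)])
      (use assms(2,5,6,7) w v in \<open>auto simp: incident_def doubleton_eq_iff\<close>)
  moreover have "incident S v = incident T v - {{v, x}, {v, y}}"
    using S by (auto simp: incident_def)
  ultimately have "incident S v = {{v, w}}"
    using w v by (auto simp: doubleton_eq_iff)
  then have "v \<in> leaves S"
    using v S by (simp add: leaves_def degree_def)
  then show gr: "grafted S T v x y"
    using assms(2,3,4,5,6) S by (auto simp: grafted_def leaves_def)
  have "connected_graph S" "\<nexists>p. cycle S p"
    using TD(2,3) grafted_connected_iff[OF gr G] grafted_acyclic_iff[OF gr G] by auto
  moreover have "degree S u = 1 \<or> degree S u = 3" if u: "u \<in> verts S" for u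
  proof (cases "u = v")
    case True
    then show ?thesis using \<open>v \<in> leaves S\<close> by (simp add: leaves_def)
  next
    case False
    moreover have "u \<noteq> x" "u \<noteq> y" "u \<in> verts T"
      using u S by auto
    ultimately show ?thesis
      using TD(4)[of u] grafted_degree(1)[OF gr G, of u] by simp
  qed
  moreover have "w \<in> verts S" "degree S w = 3"
    using grafted_degree(1)[OF gr G, of w] w S inner_degree[OF T w(1) assms(8)]
    by (auto simp: degree_def)
  ultimately show "trivalent S"
    using G by (auto simp: trivalent_def is_tree_def)
qed

section \<open>Renumbering labels\<close>

text \<open>
  The inverse of \<^const>\<open>decrease_above\<close> on the labels other than \<open>m\<close>: it frees the label \<open>m\<close>. Being
  strictly monotone on all integers, it preserves every comparison made in a tournament.
\<close>
definition increase_from :: "int \<Rightarrow> int \<Rightarrow> int" where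
  "increase_from m l = (if m \<le> l then l + 1 else l)"

lemma increase_from_less_iff [simp]: "increase_from m k < increase_from m l \<longleftrightarrow> k < l"
  by (auto simp: increase_from_def)

lemma increase_from_le_iff [simp]: "increase_from m k \<le> increase_from m l \<longleftrightarrow> k \<le> l"
  by (auto simp: increase_from_def)

lemma increase_from_eq_iff [simp]: "increase_from m k = increase_from m l \<longleftrightarrow> k = l"
  by (auto simp: increase_from_def)

lemma increase_from_neq [simp]: "increase_from m l \<noteq> m" "m \<noteq> increase_from m l"
  by (auto simp: increase_from_def)

lemma increase_decrease: "l \<noteq> m \<Longrightarrow> increase_from m (decrease_above m l) = l"
  by (auto simp: increase_from_def decrease_above_def)

lemma increase_from_image:
  assumes "- 2 \<le> m" "m \<le> int n" "1 \<le> n"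
  shows "increase_from m ` {- 2..int (n - 1)} = {- 2..int n} - {m}"
proof (intro equalityI subsetI)
  fix l assume "l \<in> {- 2..int n} - {m}"
  then have "l = increase_from m (decrease_above m l)" "decrease_above m l \<in> {- 2..int (n - 1)}"
    using assms increase_decrease[of l m] by (auto simp: decrease_above_def)
  then show "l \<in> increase_from m ` {- 2..int (n - 1)}" by blast
qed (use assms in \<open>auto simp: increase_from_def\<close>)

section \<open>Weak compositions\<close>

lemma entry_Suc: "entry k (int (Suc p)) = k ! p"
  unfolding entry_def nat_int by simp

lemma all_entries_iff: "(\<forall>l\<in>{1..int (length k)}. P (entry k l)) \<longleftrightarrow> (\<forall>c\<in>set k. P c)"
proof
  assume *: "\<forall>l\<in>{1..int (length k)}. P (entry k l)"
  show "\<forall>c\<in>set k. P c"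
  proof
    fix c assume "c \<in> set k"
    then obtain p where "p < length k" "c = k ! p" by (metis in_set_conv_nth)
    then show "P c" using *[rule_format, of "int (Suc p)"] entry_Suc[of k p] by simp
  qed
next
  assume *: "\<forall>c\<in>set k. P c"
  show "\<forall>l\<in>{1..int (length k)}. P (entry k l)"
  proof
    fix l assume "l \<in> {1..int (length k)}"
    then have "nat l - 1 < length k" by auto
    then show "P (entry k l)" using * by (simp add: entry_def)
  qed
qed

lemma sum_list_eq_length:
  fixes k :: "nat list"
  assumes "\<forall>c\<in>set k. 1 \<le> c" "sum_list k = length k"
  shows "\<forall>c\<in>set k. c = 1"
proof -
  have "length k \<le> sum_list k \<and> (sum_list k = length k \<longrightarrow> (\<forall>c\<in>set k. c = 1))"
    if "\<forall>c\<in>set k. 1 \<le> c" for k :: "nat list"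
    using that by (induction k) auto
  then show ?thesis using assms by blast
qed

lemma weak_composition_ones:
  assumes "weak_composition n k" "\<And>l. 1 \<le> l \<Longrightarrow> l \<le> int n \<Longrightarrow> 1 \<le> entry k l"
  shows "\<forall>l\<in>{1..int n}. entry k l = 1"
proof -
  have "\<forall>c\<in>set k. 1 \<le> c"
    using assms all_entries_iff[of k "\<lambda>c. 1 \<le> c"] by (auto simp: weak_composition_def)
  then have "\<forall>c\<in>set k. c = 1"
    using sum_list_eq_length assms(1) by (simp add: weak_composition_def)
  then show ?thesis
    using all_entries_iff[of k "\<lambda>c. c = 1"] assms(1) by (auto simp: weak_composition_def)
qed

text \<open>
  A weak composition of \<open>n\<close> of length \<open>n\<close> without a zero is constantly 1, so the case
  distinction in \<^const>\<open>rightmost_zero\<close> amounts to whether there is a zero at all; the value 0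
  stands for the label \<open>c\<close>.
\<close>
lemma rightmost_zero_props:
  assumes "weak_composition n k"
  shows "0 \<le> rightmost_zero k" "rightmost_zero k \<le> int n"
    "1 \<le> rightmost_zero k \<Longrightarrow> entry k (rightmost_zero k) = 0"
    "rightmost_zero k < l \<Longrightarrow> l \<le> int n \<Longrightarrow> 1 \<le> entry k l"
proof -
  have len: "length k = n" using assms by (simp add: weak_composition_def)
  define Z where "Z = {l \<in> {1..int n}. entry k l = 0}"
  have "0 \<le> rightmost_zero k \<and> rightmost_zero k \<le> int n \<and>
      (1 \<le> rightmost_zero k \<longrightarrow> entry k (rightmost_zero k) = 0) \<and>
      (\<forall>l. rightmost_zero k < l \<longrightarrow> l \<le> int n \<longrightarrow> 1 \<le> entry k l)"
  proof (cases "\<forall>l\<in>{1..int n}. entry k l = 1")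
    case True
    then show ?thesis by (auto simp: rightmost_zero_def len)
  next
    case False
    then have "rightmost_zero k = Max Z"
      unfolding rightmost_zero_def len Z_def by (rule if_not_P)
    moreover have fin: "finite Z" unfolding Z_def by (rule finite_subset[of _ "{1..int n}"]) auto
    moreover have "Z \<noteq> {}"
    proof
      assume "Z = {}"
      then have "1 \<le> entry k l" if "1 \<le> l" "l \<le> int n" for l
        using that unfolding Z_def by (auto simp: Suc_le_eq)
      then show False using weak_composition_ones[OF assms] False by blast
    qed
    ultimately have Z: "rightmost_zero k \<in> Z" "\<And>l. l \<in> Z \<Longrightarrow> l \<le> rightmost_zero k"
      by simp_all
    have rz: "1 \<le> rightmost_zero k" "rightmost_zero k \<le> int n" "entry k (rightmost_zero k) = 0"
      using Z(1) by (simp_all add: Z_def)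
    have "1 \<le> entry k l" if "rightmost_zero k < l" "l \<le> int n" for l
    proof (rule ccontr)
      assume "\<not> 1 \<le> entry k l"
      then have "l \<in> Z" using that rz(1) by (simp add: Z_def)
      then show False using Z(2) that(1) by fastforce
    qed
    then show ?thesis using rz by auto
  qed
  then show "0 \<le> rightmost_zero k" "rightmost_zero k \<le> int n"
    "1 \<le> rightmost_zero k \<Longrightarrow> entry k (rightmost_zero k) = 0"
    "rightmost_zero k < l \<Longrightarrow> l \<le> int n \<Longrightarrow> 1 \<le> entry k l" by auto
qed

lemma rightmost_zero_eqI:
  assumes "weak_composition n k" "0 \<le> i" "i \<le> int n" "1 \<le> i \<Longrightarrow> entry k i = 0"
    "\<And>l. i < l \<Longrightarrow> l \<le> int n \<Longrightarrow> 1 \<le> entry k l"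
  shows "rightmost_zero k = i"
proof -
  note rz = rightmost_zero_props[OF assms(1)]
  have "\<not> i < rightmost_zero k"
    using assms(5)[of "rightmost_zero k"] rz(2,3) assms(2) by auto
  moreover have "\<not> rightmost_zero k < i"
    using rz(4)[of i] rz(1) assms(3,4) by auto
  ultimately show ?thesis by simp
qed

text \<open>Positions count from 1, as in \<^const>\<open>entry\<close>.\<close>
definition remove_entry :: "nat list \<Rightarrow> int \<Rightarrow> nat list" where
  "remove_entry k m = take (nat m - 1) k @ drop (nat m) k"

text \<open>
  Deleting position \<open>m\<close> renumbers positions in the way in which the removal of label \<open>m\<close>
  renumbers labels.
\<close>
lemma entry_remove_entry:
  assumes "1 \<le> m" "m \<le> int (length k)" "1 \<le> l" "l \<le> int (length k) - 1"
  shows "entry (remove_entry k m) l = entry k (increase_from m l)"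
proof (cases "m \<le> l")
  case True
  then have "nat m + (nat l - 1 - (nat m - 1)) = nat (l + 1) - 1" "\<not> nat l - 1 < nat m - 1"
    using assms by auto
  then show ?thesis
    using True assms by (simp add: entry_def remove_entry_def increase_from_def nth_append min_absorb2)
next
  case False
  then have "nat l - 1 < nat m - 1" "nat l - 1 < length k" using assms by auto
  then show ?thesis
    using False assms by (simp add: entry_def remove_entry_def increase_from_def nth_append)
qed

lemma split_at_entry:
  assumes "1 \<le> m" "m \<le> int (length k)"
  shows "k = take (nat m - 1) k @ entry k m # drop (nat m) k"
  using id_take_nth_drop[of "nat m - 1" k] assms by (simp add: entry_def Suc_diff_Suc)

lemma remove_entry_props:
  assumes "1 \<le> m" "m \<le> int (length k)"
  shows "length (remove_entry k m) = length k - 1"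
    "sum_list (remove_entry k m) + entry k m = sum_list k"
proof -
  show "length (remove_entry k m) = length k - 1"
    using assms by (simp add: remove_entry_def)
  have "sum_list k = sum_list (take (nat m - 1) k @ entry k m # drop (nat m) k)"
    using split_at_entry[OF assms] by simp
  then show "sum_list (remove_entry k m) + entry k m = sum_list k"
    by (simp add: remove_entry_def)
qed

lemma remove_rightmost_zero_eq:
  assumes "1 \<le> m" "m \<le> int (length k)" "entry k m = 0"
    "\<And>l. m < l \<Longrightarrow> l \<le> int (length k) \<Longrightarrow> entry k l \<noteq> 0"
  shows "remove_rightmost_zero k = remove_entry k m"
proof -
  have "0 \<notin> set (drop (nat m) k)"
  proof
    assume "0 \<in> set (drop (nat m) k)"
    then obtain p where p: "p < length k - nat m" "k ! (nat m + p) = 0"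
      by (auto simp: in_set_conv_nth)
    then have "m < int (Suc (nat m + p))" "int (Suc (nat m + p)) \<le> int (length k)"
      using assms(1) by linarith+
    then show False
      using assms(4) entry_Suc[of k "nat m + p"] p(2) by metis
  qed
  moreover have "rev k = rev (drop (nat m) k) @ 0 # rev (take (nat m - 1) k)"
    using arg_cong[OF split_at_entry[OF assms(1,2)], of rev] assms(3) by simp
  ultimately show ?thesis
    by (simp add: remove_rightmost_zero_def remove_entry_def remove1_append)
qed

text \<open>
  The wins that remain after \<open>j\<close> has won a round after which the label \<open>m\<close> no longer occurs.
\<close>
definition play_round :: "nat list \<Rightarrow> int \<Rightarrow> int \<Rightarrow> nat list" where
  "play_round k j m = remove_entry (k[nat j - 1 := entry k j - 1]) m"

lemma entry_lowered:
  assumes "1 \<le> j" "j \<le> int (length k)" "1 \<le> l"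
  shows "entry (k[nat j - 1 := entry k j - 1]) l = (if l = j then entry k j - 1 else entry k l)"
proof (cases "l = j")
  case False
  then have "nat l - 1 \<noteq> nat j - 1" using assms by auto
  then show ?thesis using False by (simp add: entry_def)
next
  case True
  moreover have "nat j - 1 < length k" using assms by auto
  ultimately show ?thesis by (simp add: entry_def)
qed

lemma play_round_props:
  assumes "length k = n" "1 \<le> j" "j \<le> int n" "1 \<le> m" "m \<le> int n" "1 \<le> entry k j"
  shows "length (play_round k j m) = n - 1"
    "1 \<le> l \<Longrightarrow> l \<le> int n - 1 \<Longrightarrow>
      entry k (increase_from m l) = (if increase_from m l = j then 1 else 0) + entry (play_round k j m) l"
    "weak_composition n k \<Longrightarrow> entry k m = (if m = j then 1 else 0) \<Longrightarrow>
      weak_composition (n - 1) (play_round k j m)"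
proof -
  let ?k = "k[nat j - 1 := entry k j - 1]"
  show len: "length (play_round k j m) = n - 1"
    using remove_entry_props(1)[of m ?k] assms by (simp add: play_round_def)
  show "entry k (increase_from m l) =
      (if increase_from m l = j then 1 else 0) + entry (play_round k j m) l"
    if "1 \<le> l" "l \<le> int n - 1"
  proof -
    have "1 \<le> increase_from m l" using that by (simp add: increase_from_def)
    then have "entry (play_round k j m) l =
        (if increase_from m l = j then entry k j - 1 else entry k (increase_from m l))"
      using that assms entry_remove_entry[of m ?k l] entry_lowered[of j k "increase_from m l"]
      by (simp add: play_round_def)
    then show ?thesis using assms(6) by auto
  qed
  assume w: "weak_composition n k" and m: "entry k m = (if m = j then 1 else 0)"
  have "sum_list ?k = sum_list k - 1"
    using sum_list_update[of "nat j - 1" k "entry k j - 1"] assms by (auto simp: entry_def)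
  moreover have "sum_list (play_round k j m) + entry ?k m = sum_list ?k"
    using remove_entry_props(2)[of m ?k] assms by (simp add: play_round_def)
  moreover have "entry ?k m = 0"
    using entry_lowered[of j k m] assms m by auto
  ultimately show "weak_composition (n - 1) (play_round k j m)"
    using len w by (simp add: weak_composition_def)
qed

text \<open>
  The label that disappears from the tree under \<^const>\<open>pi_lazy_tree\<close> when \<open>j\<close> wins the first round.
\<close>
definition removed_label :: "nat list \<Rightarrow> int \<Rightarrow> int" where
  "removed_label k j = (if entry k j > 1 then rightmost_zero k else j)"

text \<open>
  The entry at the removed label is what the first round contributes to it. Once this round is
  deducted, the position of that label is the rightmost zero, so that \<^const>\<open>tilde\<close> deletes this
  very position.
\<close>
lemma removed_label_props:
  assumes "weak_composition n k" "1 \<le> j" "j \<le> int n" "rightmost_zero k < j"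
  shows "1 \<le> removed_label k j" "removed_label k j \<le> int n"
    "entry k (removed_label k j) = (if removed_label k j = j then 1 else 0)"
    "tilde k j = play_round k j (removed_label k j)"
proof -
  note rz = rightmost_zero_props[OF assms(1)]
  have kj: "1 \<le> entry k j" using rz(4) assms by blast
  have pos: "1 \<le> rightmost_zero k" if "entry k j > 1"
  proof (rule ccontr)
    assume "\<not> 1 \<le> rightmost_zero k"
    then have "\<forall>l\<in>{1..int n}. entry k l = 1"
      using rz(4) weak_composition_ones[OF assms(1)] by auto
    then show False using that assms(2,3) by auto
  qed
  show m: "1 \<le> removed_label k j" "removed_label k j \<le> int n"
    "entry k (removed_label k j) = (if removed_label k j = j then 1 else 0)"
    using pos rz(2,3) assms kj by (auto simp: removed_label_def)
  have len: "length k = n" using assms(1) by (simp add: weak_composition_def)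
  show "tilde k j = play_round k j (removed_label k j)"
    unfolding tilde_def play_round_def
  proof (rule remove_rightmost_zero_eq)
    fix l assume l: "removed_label k j < l" "l \<le> int (length (k[nat j - 1 := entry k j - 1]))"
    have "rightmost_zero k \<le> removed_label k j" using assms(4) by (simp add: removed_label_def)
    then have "1 \<le> entry k l" using rz(4)[of l] l len by simp
    moreover have "l = j \<Longrightarrow> 1 < entry k j" using l(1) by (auto simp: removed_label_def split: if_splits)
    ultimately show "entry (k[nat j - 1 := entry k j - 1]) l \<noteq> 0"
      using entry_lowered[of j k l] assms len m(1) l by auto
  qed (use m len entry_lowered[of j k "removed_label k j"] assms kj in auto)
qed

text \<open>
  Lowering an entry above 1 creates no zero, so only zeros left of the deleted one remain;
  lowering an entry equal to 1 creates a zero that is deleted at once.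
\<close>
lemma rightmost_zero_tilde:
  assumes "weak_composition n k" "1 \<le> j" "j \<le> int n" "rightmost_zero k < j"
  shows "weak_composition (n - 1) (tilde k j)"
    "entry k j > 1 \<Longrightarrow> rightmost_zero (tilde k j) < rightmost_zero k"
    "entry k j = 1 \<Longrightarrow> rightmost_zero (tilde k j) = rightmost_zero k"
proof -
  note rz = rightmost_zero_props[OF assms(1)] and m = removed_label_props[OF assms]
  have kj: "1 \<le> entry k j" using rz(4) assms by blast
  have len: "length k = n" using assms(1) by (simp add: weak_composition_def)
  note pr = play_round_props[OF len assms(2,3) m(1,2) kj]
  show w: "weak_composition (n - 1) (tilde k j)"
    using pr(3) assms(1) m(3,4) by simp
  note rz' = rightmost_zero_props[OF w]
  show "rightmost_zero (tilde k j) < rightmost_zero k" if "entry k j > 1"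
  proof (rule ccontr)
    let ?l = "rightmost_zero (tilde k j)"
    assume neg: "\<not> ?l < rightmost_zero k"
    have mi: "removed_label k j = rightmost_zero k" using that by (simp add: removed_label_def)
    then have l: "1 \<le> ?l" "?l \<le> int n - 1" using neg m(1) rz'(2) assms by auto
    have "entry (tilde k j) ?l = 0" using rz'(3) l by simp
    moreover have "increase_from (rightmost_zero k) ?l = ?l + 1"
      using neg by (simp add: increase_from_def)
    ultimately have "entry k (?l + 1) = (if ?l + 1 = j then 1 else 0)"
      using pr(2)[OF l] m(4) mi by simp
    moreover have "1 \<le> entry k (?l + 1)" using rz(4) neg l by auto
    ultimately show False using that by (auto split: if_splits)
  qed
  show "rightmost_zero (tilde k j) = rightmost_zero k" if "entry k j = 1"
  proof (rule rightmost_zero_eqI[OF w])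
    have mj: "removed_label k j = j" using that by (simp add: removed_label_def)
    show "0 \<le> rightmost_zero k" "rightmost_zero k \<le> int (n - 1)"
      using rz(1) assms by auto
    show "entry (tilde k j) (rightmost_zero k) = 0" if "1 \<le> rightmost_zero k"
      using pr(2)[of "rightmost_zero k"] m(4) mj rz(3) that assms by (simp add: increase_from_def)
    fix l assume l: "rightmost_zero k < l" "l \<le> int (n - 1)"
    then have "1 \<le> entry k (increase_from j l)"
      using rz(4)[of "increase_from j l"] assms by (auto simp: increase_from_def)
    then show "1 \<le> entry (tilde k j) l"
      using pr(2)[of l] m(4) mj l rz(1) assms by (auto simp del: One_nat_def)
  qed
qed

text \<open>
  The converse of the second part of \<open>rightmost_zero_tilde\<close>: if no zero remains at or right of
  \<open>i\<close> after the round, then \<open>i\<close> was the rightmost zero before it, and \<open>j\<close> has a further win.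
\<close>
lemma rightmost_zero_raise:
  assumes w: "weak_composition n k" and j: "1 \<le> j" "j \<le> int n" and i: "1 \<le> i" "i < j"
    and kj: "1 \<le> entry k j" and ki: "entry k i = 0"
    and less: "rightmost_zero (play_round k j i) < i"
  shows "rightmost_zero k = i" "1 < entry k j"
proof -
  have len: "length k = n" using w by (simp add: weak_composition_def)
  have "i \<le> int n" using i j by simp
  note pr = play_round_props[OF len j i(1) this kj]
  have w': "weak_composition (n - 1) (play_round k j i)"
    using pr(3) w ki i by simp
  have later: "(if l = j then 2 else 1) \<le> entry k l" if l: "i < l" "l \<le> int n" for l
  proof -
    \<comment> \<open>Position \<open>l\<close> of \<open>k\<close> becomes position \<open>l - 1 \<ge> i\<close>, which is right of the rightmost zero.\<close>
    have "1 \<le> entry (play_round k j i) (l - 1)"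
      using rightmost_zero_props(4)[OF w', of "l - 1"] less l i by auto
    moreover have "increase_from i (l - 1) = l" using l by (simp add: increase_from_def)
    ultimately show ?thesis using pr(2)[of "l - 1"] l i by auto
  qed
  show "rightmost_zero k = i"
  proof (rule rightmost_zero_eqI[OF w])
    show "1 \<le> entry k l" if "i < l" "l \<le> int n" for l
      using later[OF that] by (auto split: if_splits)
  qed (use i j ki in auto)
  show "1 < entry k j" using later[of j] i j by simp
qed

text \<open>The converse of the third part of \<open>rightmost_zero_tilde\<close>.\<close>
lemma rightmost_zero_keep:
  assumes w: "weak_composition n k" and j: "1 \<le> j" "j \<le> int n" and i: "0 \<le> i" "i < j"
    and kj: "entry k j = 1" and eq: "rightmost_zero (play_round k j j) = i"
  shows "rightmost_zero k = i"
proof -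
  have len: "length k = n" using w by (simp add: weak_composition_def)
  note pr = play_round_props[OF len j j, simplified kj, OF order_refl]
  have w': "weak_composition (n - 1) (play_round k j j)"
    using pr(3) w by simp
  note rz = rightmost_zero_props[OF w', unfolded eq]
  show ?thesis
  proof (rule rightmost_zero_eqI[OF w i(1)])
    show "i \<le> int n" using i j by simp
    show "entry k i = 0" if "1 \<le> i"
      using pr(2)[of i] rz(3) that i j by (simp add: increase_from_def)
    fix l assume l: "i < l" "l \<le> int n"
    show "1 \<le> entry k l"
    proof (cases "l = j")
      case False
      define l' where "l' = decrease_above j l"
      have l': "increase_from j l' = l" "i < l'" "l' \<le> int (n - 1)"
        using increase_decrease[OF False] False l i j by (auto simp: l'_def decrease_above_def)
      then have "1 \<le> entry (play_round k j j) l'" using rz(4) by blast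
      then show ?thesis using pr(2)[of l'] l' i j by auto
    qed (use kj in simp)
  qed
qed

section \<open>The tournament on a pruned tree\<close>

definition ab_cherry :: "tree \<Rightarrow> bool" where
  "ab_cherry T \<longleftrightarrow> (\<exists>v x y. x \<in> leaves T \<and> label T x = label_a \<and> y \<in> leaves T \<and> label T y = label_b \<and>
     {x, v} \<in> edges T \<and> {y, v} \<in> edges T)"

lemma tour_trees_iff:
  "T \<in> tour_trees k \<longleftrightarrow> T \<in> labeled_trees (length k) \<and> ab_cherry T \<and>
     (\<exists>L rs. lazy_tournament T L rs \<and> (\<forall>l\<in>{1..int (length k)}. rounds_won rs l = entry k l))"
  by (simp add: tour_trees_def ab_cherry_def)

text \<open>
  \<open>S\<close> is \<open>T\<close> without the cherry \<open>x\<close>, \<open>y\<close> with labels \<open>i < j\<close>. The label \<open>m\<close> is one of \<open>i\<close> and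
  \<open>j\<close>, namely the one that \<open>S\<close> loses; the other one moves to \<open>v\<close>. Which of the two is lost is
  left open, and the trees need not carry the labels of any particular \<open>X\<^sub>n\<close>, so that the same
  setting serves for pruning and for grafting.
\<close>
locale cherry_removal =
  fixes T S :: tree and v x y :: nat and i j m :: int
  assumes trivalent_S: "trivalent S"
    and grafted: "grafted S T v x y"
    and label_x: "label T x = i" and label_y: "label T y = j" and loser_less: "i < j"
    and stump: "m = i \<and> increase_from m (label S v) = j \<or> m = j \<and> increase_from m (label S v) = i"
    and label_other: "\<And>z. z \<in> leaves S \<Longrightarrow> z \<noteq> v \<Longrightarrow> label T z = increase_from m (label S z)"
begin

abbreviation up where "up \<equiv> increase_from m"

lemma graph_S: "finite_simple_graph S"
  using trivalentD(1)[OF trivalent_S] .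

lemma trivalent_T: "trivalent T"
  using grafted_trivalent[OF grafted trivalent_S] .

lemmas leaves_T = grafted_leaves[OF grafted graph_S]
lemmas incident_T = grafted_incident[OF grafted graph_S]

lemma graft_facts: "v \<in> leaves S" "v \<in> verts S" "x \<notin> verts S" "y \<notin> verts S" "x \<noteq> y"
  "verts T = verts S \<union> {x, y}" "edges T = edges S \<union> {{v, x}, {v, y}}" "v \<notin> leaves T"
  "x \<in> leaves T" "y \<in> leaves T" "x \<noteq> v" "y \<noteq> v"
  using grafted leaves_T by (auto simp: grafted_def leaves_def)

lemma edge_S_avoids: "h \<in> edges S \<Longrightarrow> x \<notin> h" "h \<in> edges S \<Longrightarrow> y \<notin> h"
  using edge_through[OF graph_S, of h] graft_facts(3,4) edge_endpoints[OF graph_S] by metis+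

text \<open>
  The neighbour of \<open>v\<close> in \<open>S\<close>, at the far end of the edge that the first round labels.
\<close>
definition neck :: nat where "neck = (SOME w. {v, w} \<in> edges S)"

abbreviation neck_edge :: "nat set" where "neck_edge \<equiv> {v, neck}"

lemma neck: "neck_edge \<in> edges S" "neck \<noteq> v" "neck \<noteq> x" "neck \<noteq> y" "neck \<in> verts S" "neck \<notin> leaves S"
  "neck \<notin> leaves T" "neck_edge \<in> edges T" "neck \<in> verts T"
proof -
  have "\<exists>w. {v, w} \<in> edges S"
    using leaf_edge_exists[OF graph_S graft_facts(1)] by blast
  then show e: "neck_edge \<in> edges S"
    unfolding neck_def by (rule someI_ex)
  show n: "neck \<noteq> v" "neck \<in> verts S"
    using edge_endpoints[OF graph_S e] by auto
  then show "neck \<noteq> x" "neck \<noteq> y" using graft_facts by auto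
  show "neck \<notin> leaves S"
    using leaf_neighbour_inner[OF trivalent_S graft_facts(1)] e by (metis insert_commute)
  then show "neck \<notin> leaves T"
    using \<open>neck \<noteq> x\<close> \<open>neck \<noteq> y\<close> leaves_T by auto
  show "neck_edge \<in> edges T" "neck \<in> verts T" using e n graft_facts by auto
qed

lemma edge_S_at_v: "h \<in> edges S \<Longrightarrow> v \<in> h \<Longrightarrow> h = neck_edge"
  using leaf_edge_unique[OF graft_facts(1) _ neck(1)] by blast

lemma incident_S_v: "incident S v = {neck_edge}"
  unfolding incident_def using edge_S_at_v neck(1) by blast

lemma incident_T_v: "incident T v = {{v, x}, {v, y}, neck_edge}"
  unfolding incident_T(2) incident_S_v by blast

lemma cherry_edges_T: "{v, x} \<in> edges T" "{v, y} \<in> edges T"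
  using graft_facts by auto

text \<open>
  The renumbering maps the labels of \<open>S\<close> onto those of \<open>T\<close> other than \<open>m\<close>.
\<close>
lemma labeled_iff:
  assumes "1 \<le> n" "- 2 \<le> m" "m \<le> int n"
  shows "T \<in> labeled_trees n \<longleftrightarrow> S \<in> labeled_trees (n - 1)"
proof -
  \<comment> \<open>\<open>\<phi>\<close> sends a leaf of \<open>S\<close> to the leaf of \<open>T\<close> with the corresponding label; \<open>d\<close> is the leaf labeled \<open>m\<close>.\<close>
  define \<phi> where "\<phi> z = (if z = v then (if m = i then y else x) else z)" for z
  define d where "d = (if m = i then x else y)"
  have leaves: "leaves T = insert d (\<phi> ` leaves S)"
    using graft_facts(1) leaves_T by (auto simp: \<phi>_def d_def)
  have "x \<notin> leaves S" "y \<notin> leaves S"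
    using graft_facts by (auto simp: leaves_def)
  then have \<phi>: "inj_on \<phi> (leaves S)" "d \<notin> \<phi> ` leaves S"
    using graft_facts(5,11,12) by (auto simp: inj_on_def \<phi>_def d_def)
  have label_d: "label T d = m"
    using label_x label_y stump by (auto simp: d_def)
  have label_\<phi>: "label T (\<phi> z) = up (label S z)" if "z \<in> leaves S" for z
    using that label_x label_y stump label_other loser_less by (auto simp: \<phi>_def)
  have image: "label T ` leaves T = insert m (up ` label S ` leaves S)"
    using label_\<phi> by (auto simp: leaves label_d image_iff)
  have "label T d \<notin> label T ` \<phi> ` leaves S"
  proof
    assume "label T d \<in> label T ` \<phi> ` leaves S"
    then obtain z where "z \<in> leaves S" "label T d = label T (\<phi> z)" by blast
    then show False using label_\<phi> label_d by simp
  qed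
  then have "inj_on (label T) (leaves T) \<longleftrightarrow> inj_on (label T) (\<phi> ` leaves S)"
    unfolding leaves inj_on_insert by blast
  also have "\<dots> \<longleftrightarrow> inj_on (label T \<circ> \<phi>) (leaves S)"
    using comp_inj_on_iff[OF \<phi>(1)] by blast
  also have "\<dots> \<longleftrightarrow> inj_on (up \<circ> label S) (leaves S)"
    by (rule inj_on_cong) (simp add: label_\<phi>)
  also have "\<dots> \<longleftrightarrow> inj_on (label S) (leaves S)"
    by (simp add: inj_on_def)
  finally have inj: "inj_on (label T) (leaves T) \<longleftrightarrow> inj_on (label S) (leaves S)" .
  have "m \<in> {- 2..int n}" using assms by simp
  then have "label T ` leaves T = {- 2..int n} \<longleftrightarrow> up ` label S ` leaves S = {- 2..int n} - {m}"
    unfolding image by (auto simp: insert_Diff)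
  also have "\<dots> \<longleftrightarrow> label S ` leaves S = {- 2..int (n - 1)}"
    unfolding increase_from_image[OF assms(2,3,1), symmetric]
    by (rule inj_image_eq_iff) (simp add: inj_on_def)
  finally show ?thesis
    using inj trivalent_S trivalent_T by (simp add: labeled_trees_def bij_betw_def labels_eq)
qed

lemma ab_cherry_iff:
  assumes "0 \<le> i"
  shows "ab_cherry T \<longleftrightarrow> ab_cherry S"
proof -
  have m: "0 \<le> m" using stump assms loser_less by auto
  have up_neg: "up l = l" if "l < 0" for l
    using m that by (simp add: increase_from_def)
  have "0 \<le> label S v"
    using stump m assms loser_less by (auto simp: increase_from_def split: if_splits)
  then have not_v: "z \<noteq> v" if "label S z < 0" for z
    using that by auto
  have leaf: "z \<in> leaves T \<and> label T z = l \<longleftrightarrow> z \<in> leaves S \<and> label S z = l" if "l < 0" for z l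
  proof
    assume z: "z \<in> leaves T \<and> label T z = l"
    then have "z \<noteq> x" "z \<noteq> y" using that label_x label_y assms loser_less by auto
    then have z': "z \<in> leaves S" "z \<noteq> v" using z leaves_T by auto
    then have "up (label S z) = up l" using z label_other up_neg[OF that] by simp
    then show "z \<in> leaves S \<and> label S z = l" using z' by simp
  next
    assume z: "z \<in> leaves S \<and> label S z = l"
    then show "z \<in> leaves T \<and> label T z = l"
      using not_v[of z] that label_other[of z] up_neg[OF that] leaves_T by simp
  qed
  have "z \<noteq> v" "z \<noteq> x" "z \<noteq> y" if "z \<in> leaves S" "label S z < 0" for z
    using that not_v graft_facts(3,4) by (auto simp: leaves_def)
  then have edge: "{z, u} \<in> edges T \<longleftrightarrow> {z, u} \<in> edges S" if "z \<in> leaves S" "label S z < 0" for z u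
    using that unfolding graft_facts(7) by (simp add: doubleton_eq_iff)
  show ?thesis
    unfolding ab_cherry_def using leaf[of "-2"] leaf[of "-1"] edge
    by (smt (verit, best))
qed

text \<open>
  The correspondence between states of the two tournaments once the first round of \<open>T\<close> is
  over. Edges of the cherry and its third edge are labeled by then, which rules out further
  rounds at \<open>v\<close>.
\<close>
definition agrees :: "edge_labeling \<Rightarrow> edge_labeling \<Rightarrow> bool" where
  "agrees L L' \<longleftrightarrow> L {v, x} \<noteq> None \<and> L {v, y} \<noteq> None \<and> L' neck_edge \<noteq> None \<and>
     (\<forall>h\<in>edges S. L h = map_option up (L' h))"

lemma initial_label_lift:
  assumes "h \<in> edges S" "v \<notin> h"
  shows "leaf_edge_labeling T h = map_option up (leaf_edge_labeling S h)"
proof (cases "leaf_edge_labeling S h")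
  case None
  then have "\<forall>z\<in>leaves S. z \<notin> h"
    using assms by (simp add: leaf_edge_labeling_eq_None_iff)
  then have "\<forall>z\<in>leaves T. z \<notin> h"
    using edge_S_avoids[OF assms(1)] leaves_T by auto
  then have "leaf_edge_labeling T h = None"
    by (simp add: leaf_edge_labeling_eq_None_iff)
  then show ?thesis
    using None by simp
next
  case (Some l)
  then obtain z where z: "z \<in> leaves S" "z \<in> h" "label S z = l"
    using leaf_edge_labeling_SomeE[OF trivalent_S] by metis
  then have "z \<noteq> v" using assms(2) by blast
  then have "leaf_edge_labeling T h = Some (label T z)"
    using leaf_edge_labeling_leaf[OF trivalent_T, of z h] z assms(1) leaves_T graft_facts by auto
  then show ?thesis
    using Some z label_other \<open>z \<noteq> v\<close> by simp
qed

lemma initial_labels_T: "leaf_edge_labeling T {v, x} = Some i" "leaf_edge_labeling T {v, y} = Some j"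
  "leaf_edge_labeling T neck_edge = None"
proof -
  show "leaf_edge_labeling T {v, x} = Some i"
    using leaf_edge_labeling_leaf[OF trivalent_T graft_facts(9) cherry_edges_T(1)] label_x by simp
  show "leaf_edge_labeling T {v, y} = Some j"
    using leaf_edge_labeling_leaf[OF trivalent_T graft_facts(10) cherry_edges_T(2)] label_y by simp
  show "leaf_edge_labeling T neck_edge = None"
    unfolding leaf_edge_labeling_eq_None_iff using neck(7) graft_facts(8) by blast
qed

lemma initial_label_neck_S: "leaf_edge_labeling S neck_edge = Some (label S v)"
  using leaf_edge_labeling_leaf[OF trivalent_S graft_facts(1) neck(1)] by simp

text \<open>
  The first round labels the neck edge of \<open>T\<close> by the advancing label, and this edge is the
  leaf edge of \<open>v\<close> in \<open>S\<close>.
\<close>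
lemma agrees_initial:
  "agrees ((leaf_edge_labeling T)(neck_edge \<mapsto> up (label S v))) (leaf_edge_labeling S)"
  unfolding agrees_def
proof (intro conjI ballI)
  show "((leaf_edge_labeling T)(neck_edge \<mapsto> up (label S v))) {v, x} \<noteq> None"
    "((leaf_edge_labeling T)(neck_edge \<mapsto> up (label S v))) {v, y} \<noteq> None"
    "leaf_edge_labeling S neck_edge \<noteq> None"
    using initial_labels_T initial_label_neck_S by auto
  fix h assume h: "h \<in> edges S"
  show "((leaf_edge_labeling T)(neck_edge \<mapsto> up (label S v))) h = map_option up (leaf_edge_labeling S h)"
    using initial_label_lift[OF h] edge_S_at_v[OF h] initial_label_neck_S by (cases "v \<in> h") auto
qed

text \<open>
  At \<open>v\<close> nothing is left to be labeled, at \<open>x\<close> and \<open>y\<close> there is only one edge, and all other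
  vertices have the same edges in both trees.
\<close>
lemma agrees_can_compete:
  assumes "agrees L L'"
  shows "can_compete T L u e f g a b \<longleftrightarrow>
    (\<exists>a' b'. a = up a' \<and> b = up b' \<and> can_compete S L' u e f g a' b')"
proof -
  consider "u = v" | "u = x" | "u = y" | "u \<notin> {v, x, y}" by blast
  then show ?thesis
  proof cases
    case 1
    have "\<not> can_compete T L u e f g a b"
    proof
      assume c: "can_compete T L u e f g a b"
      have "g \<in> incident T v" using c 1 by (simp add: can_compete_def)
      then have "g = {v, x} \<or> g = {v, y} \<or> g = neck_edge" unfolding incident_T_v by simp
      moreover have "L neck_edge \<noteq> None" using assms neck(1) by (simp add: agrees_def)
      ultimately show False using c assms by (auto simp: can_compete_def agrees_def)
    qed
    moreover have "\<not> can_compete S L' u e f g a' b'" for a' b'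
    proof
      assume c: "can_compete S L' u e f g a' b'"
      then have "g \<in> incident S v" using 1 by (simp add: can_compete_def)
      then have "g = neck_edge" unfolding incident_S_v by simp
      then show False using c assms by (simp add: can_compete_def agrees_def)
    qed
    ultimately show ?thesis by blast
  next
    case 2
    have "\<not> can_compete T L u e f g a b"
      using 2 incident_T(3) by (auto simp: can_compete_def insert_eq_iff)
    moreover have "\<not> can_compete S L' u e f g a' b'" for a' b'
      using 2 graft_facts by (simp add: can_compete_def)
    ultimately show ?thesis by blast
  next
    case 3
    have "\<not> can_compete T L u e f g a b"
      using 3 incident_T(4) by (auto simp: can_compete_def insert_eq_iff)
    moreover have "\<not> can_compete S L' u e f g a' b'" for a' b'
      using 3 graft_facts by (simp add: can_compete_def)
    ultimately show ?thesis by blast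
  next
    case 4
    then have inc: "incident T u = incident S u" using incident_T(1) by blast
    have L: "L h = map_option up (L' h)" if "h \<in> incident S u" for h
      using assms that by (simp add: agrees_def incident_def)
    show ?thesis
    proof
      assume c: "can_compete T L u e f g a b"
      then have "L e = map_option up (L' e)" "L f = map_option up (L' f)" "L g = map_option up (L' g)"
        using L inc by (simp_all add: can_compete_def)
      then show "\<exists>a' b'. a = up a' \<and> b = up b' \<and> can_compete S L' u e f g a' b'"
        using c inc 4 graft_facts(6) by (auto simp: can_compete_def)
    next
      assume "\<exists>a' b'. a = up a' \<and> b = up b' \<and> can_compete S L' u e f g a' b'"
      then obtain a' b' where c: "a = up a'" "b = up b'" "can_compete S L' u e f g a' b'" by blast
      then have "L e = map_option up (L' e)" "L f = map_option up (L' f)" "L g = map_option up (L' g)"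
        using L by (simp_all add: can_compete_def)
      then show "can_compete T L u e f g a b"
        using c inc graft_facts(6) by (auto simp: can_compete_def)
    qed
  qed
qed

lemma agrees_face_off:
  assumes "agrees L L'"
  shows "face_off T L u e f g a b \<longleftrightarrow>
    (\<exists>a' b'. a = up a' \<and> b = up b' \<and> face_off S L' u e f g a' b')"
  unfolding face_off_def agrees_can_compete[OF assms] by fastforce

text \<open>
  The edges of the cherry meet only each other and the neck edge, which is labeled. So an
  unlabeled edge has the same neighbours in both trees.
\<close>
lemma agrees_advancing:
  assumes "agrees L L'" "g \<in> edges S" "L' g = None"
  shows "advancing T L g (up a) (up b) = up (advancing S L' g a b)"
proof -
  have "v \<notin> g"
    using assms edge_S_at_v by (auto simp: agrees_def)
  then have "{v, x} \<inter> g = {}" "{v, y} \<inter> g = {}"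
    using edge_S_avoids[OF assms(2)] by auto
  then have "(\<exists>h\<in>edges T. h \<noteq> g \<and> h \<inter> g \<noteq> {} \<and> (\<exists>u. L h = Some u \<and> u \<noteq> up b \<and> u > up a)) \<longleftrightarrow>
    (\<exists>h\<in>edges S. h \<noteq> g \<and> h \<inter> g \<noteq> {} \<and> (\<exists>u. L h = Some u \<and> u \<noteq> up b \<and> u > up a))"
    unfolding graft_facts(7) by blast
  also have "\<dots> \<longleftrightarrow>
    (\<exists>h\<in>edges S. h \<noteq> g \<and> h \<inter> g \<noteq> {} \<and> (\<exists>u. L' h = Some u \<and> u \<noteq> b \<and> u > a))"
  proof (rule bex_cong[OF refl])
    fix h assume "h \<in> edges S"
    then have "L h = map_option up (L' h)" using assms(1) by (simp add: agrees_def)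
    then show "(h \<noteq> g \<and> h \<inter> g \<noteq> {} \<and> (\<exists>u. L h = Some u \<and> u \<noteq> up b \<and> u > up a)) \<longleftrightarrow>
      (h \<noteq> g \<and> h \<inter> g \<noteq> {} \<and> (\<exists>u. L' h = Some u \<and> u \<noteq> b \<and> u > a))"
      by (cases "L' h") auto
  qed
  finally have eq: "(\<exists>h\<in>edges T. h \<noteq> g \<and> h \<inter> g \<noteq> {} \<and> (\<exists>u. L h = Some u \<and> u \<noteq> up b \<and> u > up a)) \<longleftrightarrow>
    (\<exists>h\<in>edges S. h \<noteq> g \<and> h \<inter> g \<noteq> {} \<and> (\<exists>u. L' h = Some u \<and> u \<noteq> b \<and> u > a))" .
  show ?thesis
    unfolding advancing_def eq by (rule if_distrib[symmetric])
qed

lemma agrees_update: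
  assumes "agrees L L'" "L' g = None" "g \<in> edges S"
  shows "agrees (L(g \<mapsto> up c)) (L'(g \<mapsto> c))"
  using assms by (auto simp: agrees_def)

lemma agrees_complete:
  "agrees L L' \<Longrightarrow> (\<forall>e\<in>edges T. L e \<noteq> None) \<longleftrightarrow> (\<forall>e\<in>edges S. L' e \<noteq> None)"
  by (auto simp: agrees_def graft_facts)

definition lift_rounds :: "(int \<times> int) list \<Rightarrow> (int \<times> int) list" where
  "lift_rounds rs = (i, j) # map (map_prod up up) rs"

context
  assumes first: "face_off T (leaf_edge_labeling T) v {v, x} {v, y} neck_edge i j"
    and advances: "advancing T (leaf_edge_labeling T) neck_edge i j = up (label S v)"
begin

lemma lazy_rounds_T_to_S:
  assumes inj: "inj_on (label T) (leaves T)" and "lazy_rounds T L rs"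
  shows "rs = [] \<and> L = leaf_edge_labeling T \<or>
    (\<exists>L' rs'. rs = lift_rounds rs' \<and> lazy_rounds S L' rs' \<and> agrees L L')"
  using assms(2)
proof induction
  case (round L rs u e f g a b)
  from round.IH show ?case
  proof (elim disjE exE conjE)
    assume start: "rs = []" "L = leaf_edge_labeling T"
    then have "g = neck_edge" "a = i" "b = j"
      using initial_face_off_unique[OF trivalent_T inj first, of u e f g a b] round.hyps(2) by simp_all
    then have "agrees (L(g \<mapsto> advancing T L g a b)) (leaf_edge_labeling S)"
      "rs @ [(a, b)] = lift_rounds []"
      using agrees_initial advances start by (simp_all add: lift_rounds_def)
    then show ?thesis using lazy_rounds.start by blast
  next
    fix L' rs' assume IH: "rs = lift_rounds rs'" "lazy_rounds S L' rs'" "agrees L L'"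
    obtain a' b' where ab: "a = up a'" "b = up b'" "face_off S L' u e f g a' b'"
      using round.hyps(2) agrees_face_off[OF IH(3)] by blast
    have g: "g \<in> edges S" "L' g = None"
      using ab(3) by (auto simp: face_off_def can_compete_def incident_def)
    have "agrees (L(g \<mapsto> advancing T L g a b)) (L'(g \<mapsto> advancing S L' g a' b'))"
      using agrees_update[OF IH(3) g(2,1)] agrees_advancing[OF IH(3) g] ab by simp
    moreover have "rs @ [(a, b)] = lift_rounds (rs' @ [(a', b')])"
      using IH(1) ab by (simp add: lift_rounds_def)
    ultimately show ?thesis
      using lazy_rounds.round[OF IH(2) ab(3)] by blast
  qed
qed auto

lemma lazy_rounds_S_to_T:
  assumes "lazy_rounds S L' rs"
  shows "\<exists>L. lazy_rounds T L (lift_rounds rs) \<and> agrees L L'"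
  using assms
proof induction
  case start
  show ?case
    using lazy_rounds.round[OF lazy_rounds.start first] agrees_initial advances
    by (auto simp: lift_rounds_def)
next
  case (round L' rs u e f g a b)
  then obtain L where L: "lazy_rounds T L (lift_rounds rs)" "agrees L L'" by blast
  have g: "g \<in> edges S" "L' g = None"
    using round.hyps(2) by (auto simp: face_off_def can_compete_def incident_def)
  have "face_off T L u e f g (up a) (up b)"
    using agrees_face_off[OF L(2)] round.hyps(2) by blast
  from lazy_rounds.round[OF L(1) this]
  have "lazy_rounds T (L(g \<mapsto> up (advancing S L' g a b))) (lift_rounds (rs @ [(a, b)]))"
    using agrees_advancing[OF L(2) g] by (simp add: lift_rounds_def)
  then show ?case
    using agrees_update[OF L(2) g(2,1)] by blast
qed

lemma lazy_tournament_T_to_S: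
  assumes "inj_on (label T) (leaves T)" "lazy_tournament T L rs"
  obtains L' rs' where "lazy_tournament S L' rs'" "rs = lift_rounds rs'"
proof -
  have "L \<noteq> leaf_edge_labeling T"
    using assms(2) initial_labels_T(3) neck(8) by (auto simp: lazy_tournament_def)
  moreover have "lazy_rounds T L rs"
    using assms(2) by (simp add: lazy_tournament_def)
  ultimately obtain L' rs' where "rs = lift_rounds rs'" "lazy_rounds S L' rs'" "agrees L L'"
    using lazy_rounds_T_to_S[OF assms(1)] by blast
  then show thesis
    using that agrees_complete assms(2) by (auto simp: lazy_tournament_def)
qed

lemma lazy_tournament_S_to_T:
  assumes "lazy_tournament S L' rs"
  obtains L where "lazy_tournament T L (lift_rounds rs)"
proof -
  obtain L where L: "lazy_rounds T L (lift_rounds rs)" "agrees L L'"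
    using lazy_rounds_S_to_T assms unfolding lazy_tournament_def by blast
  then have "lazy_tournament T L (lift_rounds rs)"
    using agrees_complete[OF L(2)] assms unfolding lazy_tournament_def by blast
  then show thesis by (rule that)
qed

end

text \<open>
  Renumbered labels differ from \<open>m\<close>, so \<open>m\<close> can win only the first round.
\<close>
lemma rounds_won_lift:
  "rounds_won (lift_rounds rs) (up l) = (if up l = j then 1 else 0) + rounds_won rs l"
  "rounds_won (lift_rounds rs) m = (if m = j then 1 else 0)"
proof -
  have "count_list (map snd (map (map_prod up up) rs)) (up l) = count_list (map snd rs) l"
    "count_list (map snd (map (map_prod up up) rs)) m = 0"
    by (induction rs) auto
  then show "rounds_won (lift_rounds rs) (up l) = (if up l = j then 1 else 0) + rounds_won rs l"
    "rounds_won (lift_rounds rs) m = (if m = j then 1 else 0)"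
    by (auto simp: rounds_won_def lift_rounds_def)
qed

end

context cherry_removal
begin

text \<open>
  Besides the tree \<open>S\<close>, the first round determines the entries of \<open>k\<close> at \<open>m\<close> and \<open>j\<close>: \<open>m\<close> wins
  nothing afterwards.
\<close>
lemma tour_T_to_S:
  assumes first: "face_off T (leaf_edge_labeling T) v {v, x} {v, y} neck_edge i j"
    and adv: "advancing T (leaf_edge_labeling T) neck_edge i j = up (label S v)"
    and "0 \<le> i" "1 \<le> m" and T: "T \<in> tour_trees k"
  shows "S \<in> tour_trees (play_round k j m)" "1 \<le> entry k j" "entry k m = (if m = j then 1 else 0)"
    "j \<le> int (length k)"
proof -
  define n where "n = length k"
  have Tn: "T \<in> labeled_trees n" "ab_cherry T"
    using T by (simp_all add: tour_trees_iff n_def)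
  obtain L rs where L: "lazy_tournament T L rs" "\<forall>l\<in>{1..int n}. rounds_won rs l = entry k l"
    using T by (auto simp: tour_trees_iff n_def)
  obtain L' rs' where L': "lazy_tournament S L' rs'" "rs = lift_rounds rs'"
    using lazy_tournament_T_to_S[OF first adv labeled_treesD(2)[OF Tn(1)] L(1)] by metis
  show j: "j \<le> int (length k)"
    using labeled_treesD(4)[OF Tn(1) graft_facts(10)] label_y by (simp add: n_def)
  then have jn: "1 \<le> j" "j \<le> int n" "1 \<le> n" "m \<le> int n" "1 \<le> m"
    using loser_less assms(3,4) stump by (auto simp: n_def)
  have won: "entry k l = rounds_won (lift_rounds rs') l" if "1 \<le> l" "l \<le> int n" for l
    using L(2) L'(2) that by simp
  show km: "entry k m = (if m = j then 1 else 0)"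
    using won[of m] rounds_won_lift(2) jn by simp
  show kj: "1 \<le> entry k j"
  proof (cases "m = j")
    case False
    then have "up (label S v) = j" using stump by auto
    then show ?thesis
      using won[OF jn(1,2)] rounds_won_lift(1)[of rs' "label S v"] by simp
  qed (use km in simp)
  note pr = play_round_props[OF n_def[symmetric] jn(1,2) assms(4) jn(4) kj]
  have "entry (play_round k j m) l = rounds_won rs' l" if l: "1 \<le> l" "l \<le> int (n - 1)" for l
  proof -
    have "1 \<le> up l" "up l \<le> int n" using l jn by (auto simp: increase_from_def)
    then have "entry k (up l) = (if up l = j then 1 else 0) + rounds_won rs' l"
      using won rounds_won_lift(1) by simp
    then show ?thesis using pr(2)[of l] l by simp
  qed
  moreover have "S \<in> labeled_trees (n - 1)"
    using labeled_iff[OF jn(3) _ jn(4)] jn(5) Tn(1) by simp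
  moreover have "ab_cherry S" using ab_cherry_iff[OF assms(3)] Tn(2) by simp
  ultimately show "S \<in> tour_trees (play_round k j m)"
    unfolding tour_trees_iff pr(1) using L'(1) by auto
qed

lemma tour_S_to_T:
  assumes first: "face_off T (leaf_edge_labeling T) v {v, x} {v, y} neck_edge i j"
    and adv: "advancing T (leaf_edge_labeling T) neck_edge i j = up (label S v)"
    and "0 \<le> i" "1 \<le> m" "j \<le> int (length k)" "1 \<le> entry k j"
    and m: "entry k m = (if m = j then 1 else 0)" and S: "S \<in> tour_trees (play_round k j m)"
  shows "T \<in> tour_trees k"
proof -
  define n where "n = length k"
  have jn: "1 \<le> j" "j \<le> int n" "1 \<le> n" "m \<le> int n"
    using loser_less assms(3-5) stump by (auto simp: n_def)
  note pr = play_round_props[OF n_def[symmetric] jn(1,2) assms(4) jn(4) assms(6)]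
  have Sn: "S \<in> labeled_trees (n - 1)" "ab_cherry S"
    using S by (simp_all add: tour_trees_iff pr(1))
  obtain L' rs' where L': "lazy_tournament S L' rs'"
    "\<forall>l\<in>{1..int (n - 1)}. rounds_won rs' l = entry (play_round k j m) l"
    using S by (auto simp: tour_trees_iff pr(1))
  obtain L where L: "lazy_tournament T L (lift_rounds rs')"
    using lazy_tournament_S_to_T[OF first adv L'(1)] by metis
  have "rounds_won (lift_rounds rs') l = entry k l" if l: "1 \<le> l" "l \<le> int n" for l
  proof (cases "l = m")
    case True
    then show ?thesis using rounds_won_lift(2) m by simp
  next
    case False
    define l' where "l' = decrease_above m l"
    have l': "up l' = l" "1 \<le> l'" "l' \<le> int n - 1"
      using False l assms(4) jn increase_decrease[OF False] by (auto simp: l'_def decrease_above_def)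
    then have "rounds_won rs' l' = entry (play_round k j m) l'" using L'(2) jn(3) by auto
    then show ?thesis
      using rounds_won_lift(1)[of rs' l'] pr(2)[OF l'(2,3)] l'(1) by simp
  qed
  moreover have "T \<in> labeled_trees n"
    using labeled_iff[OF jn(3) _ jn(4)] assms(4) Sn(1) by simp
  moreover have "ab_cherry T" using ab_cherry_iff[OF assms(3)] Sn(2) by simp
  ultimately show ?thesis
    unfolding tour_trees_iff n_def[symmetric]
    using L by (intro conjI exI[of _ L] exI[of _ "lift_rounds rs'"]) auto
qed

end

section \<open>Isomorphisms\<close>

definition iso_map :: "(nat \<Rightarrow> nat) \<Rightarrow> tree \<Rightarrow> tree \<Rightarrow> bool" where
  "iso_map f S T \<longleftrightarrow> bij_betw f (verts S) (verts T) \<and> (\<lambda>e. f ` e) ` edges S = edges T \<and>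
     (\<forall>v\<in>leaves S. label T (f v) = label S v)"

lemma isomorphic_iff: "isomorphic S T \<longleftrightarrow> (\<exists>f. iso_map f S T)"
  by (simp add: isomorphic_def iso_map_def)

lemma edges_subset_Pow: "finite_simple_graph T \<Longrightarrow> edges T \<subseteq> Pow (verts T)"
  unfolding finite_simple_graph_def by fastforce

lemma iso_map_edge:
  assumes "iso_map f S T" "{u, w} \<in> edges S"
  shows "{f u, f w} \<in> edges T"
proof -
  have "f ` {u, w} \<in> edges T" using assms unfolding iso_map_def by blast
  then show ?thesis by simp
qed

lemma iso_map_incident:
  assumes "iso_map f S T" "finite_simple_graph S" "v \<in> verts S"
  shows "incident T (f v) = (\<lambda>e. f ` e) ` incident S v"
proof -
  have inj: "inj_on f (verts S)" and E: "(\<lambda>e. f ` e) ` edges S = edges T"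
    using assms(1) by (auto simp: iso_map_def bij_betw_def)
  have mem: "f v \<in> f ` e \<longleftrightarrow> v \<in> e" if "e \<in> edges S" for e
    using inj_on_image_mem_iff[OF inj assms(3)] edges_subset_Pow[OF assms(2)] that by blast
  show ?thesis
    unfolding incident_def E[symmetric] using mem by blast
qed

lemma iso_map_leaf_iff:
  assumes "iso_map f S T" "finite_simple_graph S" "v \<in> verts S"
  shows "f v \<in> leaves T \<longleftrightarrow> v \<in> leaves S"
proof -
  have inj: "inj_on f (verts S)" and "f v \<in> verts T"
    using assms(1,3) by (auto simp: iso_map_def bij_betw_def)
  moreover have "incident S v \<subseteq> Pow (verts S)"
    using edges_subset_Pow[OF assms(2)] unfolding incident_def by blast
  then have "inj_on (\<lambda>e. f ` e) (incident S v)"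
    using inj_on_subset[OF inj_on_image_Pow[OF inj]] by blast
  ultimately show ?thesis
    using assms(3) by (simp add: leaves_def degree_def iso_map_incident[OF assms] card_image)
qed

lemma iso_map_leaf:
  assumes "iso_map f S T" "finite_simple_graph S" "v \<in> leaves S"
  shows "f v \<in> leaves T" "label T (f v) = label S v"
proof -
  have "v \<in> verts S" using assms(3) by (simp add: leaves_def)
  then show "f v \<in> leaves T" using iso_map_leaf_iff[OF assms(1,2)] assms(3) by simp
  show "label T (f v) = label S v" using assms(1,3) by (simp add: iso_map_def)
qed

lemma iso_map_inverse:
  assumes "iso_map f S T" "finite_simple_graph S"
  shows "iso_map (inv_into (verts S) f) T S"
proof -
  let ?g = "inv_into (verts S) f"
  have bij: "bij_betw f (verts S) (verts T)" and E: "(\<lambda>e. f ` e) ` edges S = edges T"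
    using assms(1) by (auto simp: iso_map_def)
  have gf: "?g ` f ` e = e" if "e \<in> edges S" for e
  proof -
    have "e \<subseteq> verts S" "inj_on f (verts S)"
      using that edges_subset_Pow[OF assms(2)] bij by (auto simp: bij_betw_def)
    then show ?thesis by simp
  qed
  have "(\<lambda>e. ?g ` e) ` edges T = (\<lambda>e. ?g ` f ` e) ` edges S"
    unfolding E[symmetric] by (rule image_image)
  also have "\<dots> = (\<lambda>e. e) ` edges S"
    using gf by (rule image_cong[OF refl])
  finally have "(\<lambda>e. ?g ` e) ` edges T = edges S" by simp
  have "label S (?g v) = label T v" if v: "v \<in> leaves T" for v
  proof -
    have g: "?g v \<in> verts S" "f (?g v) = v"
      using v bij by (auto simp: leaves_def bij_betw_def inv_into_into f_inv_into_f)
    then have "?g v \<in> leaves S" using iso_map_leaf_iff[OF assms g(1)] v by simp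
    then show ?thesis using assms(1) g(2) by (auto simp: iso_map_def)
  qed
  with \<open>(\<lambda>e. ?g ` e) ` edges T = edges S\<close> show ?thesis
    using bij_betw_inv_into[OF bij] by (simp add: iso_map_def)
qed

lemma iso_map_comp:
  assumes "iso_map f R S" "iso_map g S T" "finite_simple_graph R"
  shows "iso_map (g \<circ> f) R T"
proof -
  have E: "(\<lambda>e. f ` e) ` edges R = edges S" "(\<lambda>e. g ` e) ` edges S = edges T"
    using assms by (auto simp: iso_map_def)
  have "(\<lambda>e. (g \<circ> f) ` e) ` edges R = (\<lambda>e. g ` f ` e) ` edges R"
    by (rule image_cong[OF refl]) (rule image_comp[symmetric])
  also have "\<dots> = edges T"
    unfolding E(2)[symmetric] E(1)[symmetric] by (rule image_image[symmetric])
  finally have "(\<lambda>e. (g \<circ> f) ` e) ` edges R = edges T" .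
  moreover have "bij_betw (g \<circ> f) (verts R) (verts T)"
    using assms by (auto simp: iso_map_def intro: bij_betw_trans)
  ultimately show ?thesis
    using iso_map_leaf[OF assms(1,3)] assms(2) by (simp add: iso_map_def)
qed

lemma labeled_tree_graph: "T \<in> labeled_trees n \<Longrightarrow> finite_simple_graph T"
  using labeled_treesD(1) trivalentD(1) by blast

lemma equiv_tree_iso: "equiv (labeled_trees n) (tree_iso n)"
proof (rule equivI)
  show "tree_iso n \<subseteq> labeled_trees n \<times> labeled_trees n"
    by (auto simp: tree_iso_def)
  have "iso_map id T T" for T
    by (auto simp: iso_map_def)
  then show "refl_on (labeled_trees n) (tree_iso n)"
    by (auto simp: refl_on_def tree_iso_def isomorphic_iff)
  show "sym (tree_iso n)"
    using iso_map_inverse labeled_tree_graph by (auto simp: sym_def tree_iso_def isomorphic_iff) blast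
  show "trans (tree_iso n)"
    using iso_map_comp labeled_tree_graph by (auto simp: trans_def tree_iso_def isomorphic_iff) blast
qed

lemma iso_map_leaf_edge_labeling:
  assumes "iso_map f S T" "trivalent S" "trivalent T" "e \<in> edges S"
  shows "leaf_edge_labeling T (f ` e) = leaf_edge_labeling S e"
proof -
  note G = trivalentD(1)[OF assms(2)]
  have e: "f ` e \<in> edges T" "e \<subseteq> verts S"
    using assms(1,4) edges_subset_Pow[OF G] by (auto simp: iso_map_def)
  show ?thesis
  proof (cases "\<exists>x\<in>leaves S. x \<in> e")
    case True
    then obtain x where x: "x \<in> leaves S" "x \<in> e" by blast
    then show ?thesis
      using leaf_edge_labeling_leaf[OF assms(2) x(1) assms(4) x(2)]
        leaf_edge_labeling_leaf[OF assms(3) iso_map_leaf(1)[OF assms(1) G x(1)] e(1)]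
        iso_map_leaf(2)[OF assms(1) G x(1)] by simp
  next
    case False
    then have "\<forall>y\<in>leaves T. y \<notin> f ` e"
      using iso_map_leaf_iff[OF assms(1) G] e(2) by blast
    then have "leaf_edge_labeling T (f ` e) = None" "leaf_edge_labeling S e = None"
      using False unfolding leaf_edge_labeling_eq_None_iff by blast+
    then show ?thesis by simp
  qed
qed

lemma iso_map_can_compete:
  assumes "iso_map f S T" "trivalent S" "trivalent T"
    "can_compete S (leaf_edge_labeling S) v e h g i j"
  shows "can_compete T (leaf_edge_labeling T) (f v) (f ` e) (f ` h) (f ` g) i j"
proof -
  have c: "v \<in> verts S" "incident S v = {e, h, g}" "leaf_edge_labeling S e = Some i"
    "leaf_edge_labeling S h = Some j" "i < j" "leaf_edge_labeling S g = None"
    using assms(4) by (auto simp: can_compete_def)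
  have "e \<in> incident S v" "h \<in> incident S v" "g \<in> incident S v"
    unfolding c(2) by simp_all
  then have "e \<in> edges S" "h \<in> edges S" "g \<in> edges S"
    by (simp_all add: incident_def)
  moreover have "f v \<in> verts T"
    using assms(1) c(1) by (auto simp: iso_map_def bij_betw_def)
  moreover have "incident T (f v) = {f ` e, f ` h, f ` g}"
    using iso_map_incident[OF assms(1) trivalentD(1)[OF assms(2)] c(1)] c(2) by simp
  ultimately show ?thesis
    using c iso_map_leaf_edge_labeling[OF assms(1-3)] by (simp add: can_compete_def)
qed

text \<open>Competing pairs are transported in both directions, so the largest loser is the same.\<close>
lemma iso_map_face_off:
  assumes "iso_map f S T" "trivalent S" "trivalent T"
    "face_off S (leaf_edge_labeling S) v e h g i j"
  shows "face_off T (leaf_edge_labeling T) (f v) (f ` e) (f ` h) (f ` g) i j"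
  unfolding face_off_def
proof (intro conjI allI impI)
  show "can_compete T (leaf_edge_labeling T) (f v) (f ` e) (f ` h) (f ` g) i j"
    using iso_map_can_compete[OF assms(1-3)] assms(4) by (simp add: face_off_def)
  fix v' e' f' g' i' j' assume "can_compete T (leaf_edge_labeling T) v' e' f' g' i' j'"
  from iso_map_can_compete[OF iso_map_inverse[OF assms(1) trivalentD(1)[OF assms(2)]] assms(3,2) this]
  show "i' \<le> i"
    using assms(4) unfolding face_off_def by blast
qed

lemma (in cherry_removal) verts_edges_S:
  "verts S = verts T - {x, y}" "edges S = edges T - {{v, x}, {v, y}}"
proof -
  show "verts S = verts T - {x, y}" using graft_facts by auto
  show "edges S = edges T - {{v, x}, {v, y}}"
    using incident_T(5,6) unfolding graft_facts(7) by blast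
qed

text \<open>
  The labels \<open>i\<close> and \<open>j\<close> force the isomorphism to map cherry to cherry, so it restricts to the
  pruned trees.
\<close>
lemma isomorphic_remove_cherries:
  assumes "cherry_removal T S v x y i j m" "cherry_removal T' S' v' x' y' i j m"
    and "inj_on (label T') (leaves T')" and "isomorphic T T'"
  shows "isomorphic S S'"
proof -
  interpret A: cherry_removal T S v x y i j m by fact
  interpret B: cherry_removal T' S' v' x' y' i j m by fact
  obtain f where f: "iso_map f T T'"
    using assms(4) isomorphic_iff by blast
  note GT = trivalentD(1)[OF A.trivalent_T] and GT' = trivalentD(1)[OF B.trivalent_T]
  note leaf = iso_map_leaf[OF f GT]
  have bij: "bij_betw f (verts T) (verts T')" and E: "(\<lambda>e. f ` e) ` edges T = edges T'"
    using f by (auto simp: iso_map_def)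
  then have inj: "inj_on f (verts T)" by (simp add: bij_betw_def)
  have fx: "f x = x'"
    using leaf[OF A.graft_facts(9)] A.label_x B.label_x B.graft_facts(9) assms(3) by (auto dest: inj_onD)
  have fy: "f y = y'"
    using leaf[OF A.graft_facts(10)] A.label_y B.label_y B.graft_facts(10) assms(3)
    by (auto dest: inj_onD)
  have fv: "f v = v'"
    using leaf_neighbour_unique[OF GT' B.graft_facts(9) _ B.cherry_edges_T(1)]
      iso_map_edge[OF f A.cherry_edges_T(1)] fx by simp
  have "f ` (verts T - {x, y}) = f ` verts T - f ` {x, y}"
    by (rule inj_on_image_set_diff[OF inj]) (use A.graft_facts(6) in auto)
  moreover have "f ` verts T = verts T'" "f ` {x, y} = {x', y'}"
    using bij fx fy by (simp_all add: bij_betw_def)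
  ultimately have "f ` verts S = verts S'"
    unfolding A.verts_edges_S B.verts_edges_S by metis
  then have bij': "bij_betw f (verts S) (verts S')"
    using inj A.graft_facts(6) by (auto simp: bij_betw_def inj_on_def)
  have "inj_on (\<lambda>e. f ` e) (edges T)"
    using inj_on_subset[OF inj_on_image_Pow[OF inj] edges_subset_Pow[OF GT]] .
  then have "(\<lambda>e. f ` e) ` (edges T - {{v, x}, {v, y}}) =
      (\<lambda>e. f ` e) ` edges T - (\<lambda>e. f ` e) ` {{v, x}, {v, y}}"
    by (rule inj_on_image_set_diff) (use A.cherry_edges_T in auto)
  moreover have "(\<lambda>e. f ` e) ` {{v, x}, {v, y}} = {{v', x'}, {v', y'}}"
    using fx fy fv by simp
  ultimately have E': "(\<lambda>e. f ` e) ` edges S = edges S'"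
    unfolding A.verts_edges_S B.verts_edges_S E by metis
  have "label S' (f z) = label S z" if z: "z \<in> leaves S" for z
  proof (cases "z = v")
    case True
    have "B.up (label S' v') = B.up (label S v)"
      using A.stump B.stump A.loser_less by auto
    then show ?thesis using True fv by simp
  next
    case False
    then have zT: "z \<in> leaves T" "z \<in> verts S" "z \<noteq> x" "z \<noteq> y"
      using z A.leaves_T A.graft_facts(3,4) by (auto simp: leaves_def)
    have "f z \<in> verts S'" using \<open>f ` verts S = verts S'\<close> zT by blast
    then have "f z \<noteq> x'" "f z \<noteq> y'" using B.graft_facts by auto
    then have fz: "f z \<in> leaves S'" "f z \<noteq> v'"
      using leaf(1)[OF zT(1)] B.leaves_T by auto
    have "B.up (label S' (f z)) = B.up (label S z)"
      using A.label_other[OF z False] B.label_other[OF fz] leaf(2)[OF zT(1)] by simp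
    then show ?thesis by simp
  qed
  then show ?thesis
    using bij' E' unfolding isomorphic_iff iso_map_def by blast
qed

text \<open>
  An isomorphism of the pruned trees respects the label at \<open>v\<close>, hence maps \<open>v\<close> to \<open>v'\<close>, and
  extends to the leaves attached there.
\<close>
lemma isomorphic_graft_cherries:
  assumes "cherry_removal T S v x y i j m" "cherry_removal T' S' v' x' y' i j m"
    and "inj_on (label S') (leaves S')" and "isomorphic S S'"
  shows "isomorphic T T'"
proof -
  interpret A: cherry_removal T S v x y i j m by fact
  interpret B: cherry_removal T' S' v' x' y' i j m by fact
  obtain f where f: "iso_map f S S'"
    using assms(4) isomorphic_iff by blast
  note leaf = iso_map_leaf[OF f A.graph_S]
  have "B.up (label S' v') = B.up (label S v)"
    using A.stump B.stump A.loser_less by auto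
  then have fv: "f v = v'"
    using leaf[OF A.graft_facts(1)] B.graft_facts(1) inj_onD[OF assms(3), of "f v" v'] by simp
  define h where "h = f(x := x', y := y')"
  have h: "h x = x'" "h y = y'" "h v = v'" "\<And>z. z \<in> verts S \<Longrightarrow> h z = f z"
    using A.graft_facts(3,4,5,11,12) fv by (auto simp: h_def)
  have bij: "bij_betw f (verts S) (verts S')" and E: "(\<lambda>e. f ` e) ` edges S = edges S'"
    using f by (auto simp: iso_map_def)
  have "bij_betw h (verts S) (verts S')"
    using bij h(4) bij_betw_cong[of "verts S" h f] by blast
  moreover have "bij_betw h {x, y} {x', y'}"
    using h B.graft_facts(5) by (auto simp: bij_betw_def)
  ultimately have bij': "bij_betw h (verts T) (verts T')"
    unfolding A.graft_facts(6) B.graft_facts(6)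
    by (rule bij_betw_combine) (use B.graft_facts in auto)
  have "h ` e = f ` e" if "e \<in> edges S" for e
    using that edges_subset_Pow[OF A.graph_S] h(4) by (intro image_cong) auto
  then have "(\<lambda>e. h ` e) ` edges S = edges S'"
    using E by (simp cong: image_cong)
  then have E': "(\<lambda>e. h ` e) ` edges T = edges T'"
    unfolding A.graft_facts(7) B.graft_facts(7) image_Un using h by simp
  have "label T' (h z) = label T z" if z: "z \<in> leaves T" for z
  proof -
    consider "z = x" | "z = y" | "z \<in> leaves S" "z \<noteq> v"
      using z A.leaves_T by blast
    then show ?thesis
    proof cases
      case 3
      then have "z \<in> verts S" by (simp add: leaves_def)
      moreover have "f z \<noteq> v'"
        using bij 3(2) fv A.graft_facts(2) \<open>z \<in> verts S\<close> by (auto simp: bij_betw_def dest: inj_onD)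
      ultimately show ?thesis
        using A.label_other[OF 3] B.label_other[OF leaf(1)[OF 3(1)]] leaf(2)[OF 3(1)] h(4) by simp
    qed (use h A.label_x A.label_y B.label_x B.label_y in simp_all)
  qed
  then show ?thesis
    using bij' E' unfolding isomorphic_iff iso_map_def by blast
qed

section \<open>The first face-off\<close>

lemma inner_vertex_exists:
  assumes "trivalent T"
  obtains v where "v \<in> verts T" "v \<notin> leaves T"
  using trivalentD(5)[OF assms] by (auto simp: leaves_def)

text \<open>
  The alternatives are that the vertex of the cherry of \<open>a\<close> and \<open>b\<close> has an inner neighbour, so
  that there is a cherry at another vertex, or that the tree is a star.
\<close>
lemma ab_cherry_cases:
  assumes T: "T \<in> labeled_trees n" and "ab_cherry T"
  obtains (star) v where "v \<in> verts T" "v \<notin> leaves T" "\<And>w. {v, w} \<in> edges T \<Longrightarrow> w \<in> leaves T"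
  | (cherry) u x y w where "x \<in> leaves T" "y \<in> leaves T" "{u, x} \<in> edges T" "{u, y} \<in> edges T"
      "{u, w} \<in> edges T" "w \<notin> leaves T" "0 \<le> label T x" "label T x < label T y"
proof -
  note TD = labeled_treesD[OF T]
  note G = trivalentD(1)[OF TD(1)]
  obtain v xa xb where ab: "xa \<in> leaves T" "label T xa = -2" "xb \<in> leaves T" "label T xb = -1"
    "{v, xa} \<in> edges T" "{v, xb} \<in> edges T"
    using assms(2)[unfolded ab_cherry_def insert_commute[of _ _ "{}"]] by blast
  have v: "v \<in> verts T" "v \<notin> leaves T"
    using edge_endpoints[OF G ab(5)] leaf_neighbour_inner[OF TD(1) ab(1,5)] by auto
  show thesis
  proof (cases "\<forall>w. {v, w} \<in> edges T \<longrightarrow> w \<in> leaves T")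
    case True
    then show thesis using star v by blast
  next
    case False
    then obtain z where "{v, z} \<in> edges T" "z \<notin> leaves T" by blast
    then obtain u x y w where c: "u \<noteq> v" "x \<noteq> y" "x \<in> leaves T" "y \<in> leaves T"
      "{u, x} \<in> edges T" "{u, y} \<in> edges T" "{u, w} \<in> edges T" "w \<notin> leaves T"
      using far_cherry[OF TD(1) v] by metis
    have nonneg: "0 \<le> label T p" if p: "p \<in> leaves T" "{u, p} \<in> edges T" for p
    proof -
      have "p \<noteq> xa" "p \<noteq> xb"
        using leaf_neighbour_unique[OF G p] ab(5,6) c(1) by blast+
      then have "label T p \<noteq> -2" "label T p \<noteq> -1"
        using inj_onD[OF TD(2), of p xa] inj_onD[OF TD(2), of p xb] p(1) ab by auto
      then show ?thesis using TD(4)[OF p(1)] by auto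
    qed
    have "label T x \<noteq> label T y"
      using inj_onD[OF TD(2), of x y] c by blast
    then consider "label T x < label T y" | "label T y < label T x" by linarith
    then show thesis
      by cases (use cherry[of x y u w] cherry[of y x u w] c nonneg in blast)+
  qed
qed

text \<open>
  A cherry whose labels are at least \<open>c\<close> is available, and the first loser is at least its
  loser.
\<close>
lemma first_loser_nonneg:
  assumes T: "T \<in> labeled_trees n" and "ab_cherry T" "1 \<le> n"
    and "face_off T (leaf_edge_labeling T) v e f g i j"
  shows "0 \<le> i"
  using assms(1,2)
proof (cases rule: ab_cherry_cases)
  case star
  then show ?thesis using star_no_numbered_leaf[OF T] assms(3) by fastforce
next
  case (cherry u x y w)
  then have "label T x \<le> i"
    using cherry_can_compete[OF labeled_treesD(1)[OF T], of x y u w] assms(4)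
    unfolding face_off_def by blast
  then show ?thesis using cherry by simp
qed

text \<open>
  A second cherry would need two labels besides \<open>a\<close> and \<open>b\<close>, but only \<open>c\<close> is there. So the
  tree is a star, and its tournament consists of no rounds.
\<close>
lemma no_inner_edge:
  assumes T: "T \<in> labeled_trees 0" and "ab_cherry T" "e \<in> edges T"
  shows "leaf_edge_labeling T e \<noteq> None"
  using assms(1,2)
proof (cases rule: ab_cherry_cases)
  case (star v)
  note TD = labeled_treesD[OF T]
  obtain p q where e: "e = {p, q}" "p \<in> verts T" "q \<in> verts T"
    using trivalentD(1)[OF TD(1)] assms(3) unfolding finite_simple_graph_def by blast
  have "p = v \<or> p \<in> leaves T"
    using star_verts[OF TD(1) star(1,3)] star(3) e(2) by blast
  then have "p \<in> leaves T \<or> q \<in> leaves T"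
    using star(3) assms(3) e(1) by blast
  then show ?thesis
    unfolding leaf_edge_labeling_eq_None_iff using e(1) assms(3) by blast
next
  case (cherry u x y w)
  then show ?thesis
    using labeled_treesD(4)[OF T, of y] by auto
qed

lemma lazy_rounds_first:
  "lazy_rounds T L rs \<Longrightarrow> L = leaf_edge_labeling T \<or>
     (\<exists>v e f g i j. face_off T (leaf_edge_labeling T) v e f g i j)"
  by (induction rule: lazy_rounds.induct) blast+

lemma inner_edge_exists:
  assumes "T \<in> labeled_trees n" "1 \<le> n" "v \<in> verts T" "v \<notin> leaves T"
  obtains w where "{v, w} \<in> edges T" "w \<notin> leaves T"
  using star_no_numbered_leaf[OF assms(1,3,4)] assms(2) by fastforce

text \<open>An inner edge is unlabeled at the start, so a complete tournament has a first round.\<close>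
lemma first_face_off_exists:
  assumes T: "T \<in> labeled_trees n" "1 \<le> n" and "lazy_tournament T L rs"
  obtains v e f g i j where "face_off T (leaf_edge_labeling T) v e f g i j"
proof -
  obtain v where v: "v \<in> verts T" "v \<notin> leaves T"
    using inner_vertex_exists[OF labeled_treesD(1)[OF T(1)]] .
  obtain w where w: "{v, w} \<in> edges T" "w \<notin> leaves T"
    using inner_edge_exists[OF T v] .
  then have "leaf_edge_labeling T {v, w} = None"
    using v(2) by (auto simp: leaf_edge_labeling_eq_None_iff)
  then have "L \<noteq> leaf_edge_labeling T"
    using assms(3) w(1) by (auto simp: lazy_tournament_def)
  then show thesis
    using lazy_rounds_first[of T L rs] assms(3) that unfolding lazy_tournament_def by blast
qed

context cherry_removal
begin

text \<open>
  Edges away from \<open>v\<close> start with the same labels up to renumbering, and the third edge of a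
  cherry of \<open>S\<close> cannot be the neck edge, which is labeled in \<open>S\<close>.
\<close>
lemma initial_compete_S_to_T:
  assumes "can_compete S (leaf_edge_labeling S) u e f g a b" "v \<notin> e" "v \<notin> f"
  shows "can_compete T (leaf_edge_labeling T) u e f g (up a) (up b)"
proof -
  have c: "u \<in> verts S" "incident S u = {e, f, g}" "leaf_edge_labeling S e = Some a"
    "leaf_edge_labeling S f = Some b" "a < b" "leaf_edge_labeling S g = None"
    using assms(1) by (simp_all add: can_compete_def)
  have "e \<in> incident S u" "f \<in> incident S u" "g \<in> incident S u"
    unfolding c(2) by simp_all
  then have E: "e \<in> edges S" "f \<in> edges S" "g \<in> edges S" "u \<in> e"
    by (simp_all add: incident_def)
  have "v \<notin> g"
    using edge_S_at_v[OF E(3)] initial_label_neck_S c(6) by auto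
  moreover have "u \<noteq> v" "u \<noteq> x" "u \<noteq> y" "u \<in> verts T"
    using E(4) assms(2) c(1) graft_facts by auto
  ultimately show ?thesis
    using c incident_T(1) initial_label_lift[OF E(1) assms(2)] initial_label_lift[OF E(2) assms(3)]
      initial_label_lift[OF E(3)] by (simp add: can_compete_def)
qed

text \<open>
  A cherry of \<open>T\<close> other than the removed one is one of \<open>S\<close>, unless its third edge is the neck
  edge: this is a leaf edge of \<open>S\<close> and labeled there.
\<close>
lemma initial_compete_T_to_S:
  assumes "can_compete T (leaf_edge_labeling T) u e f g a b" "u \<noteq> v" "g \<noteq> neck_edge"
  obtains a' b' where "a = up a'" "b = up b'" "can_compete S (leaf_edge_labeling S) u e f g a' b'"
proof -
  have c: "u \<in> verts T" "incident T u = {e, f, g}" "leaf_edge_labeling T e = Some a"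
    "leaf_edge_labeling T f = Some b" "a < b" "leaf_edge_labeling T g = None"
    using assms(1) by (simp_all add: can_compete_def)
  have "u \<notin> leaves T"
    using initial_competitors[OF trivalent_T assms(1)] by metis
  then have u: "u \<noteq> x" "u \<noteq> y" "u \<in> verts S" using graft_facts c(1) by auto
  then have inc: "incident S u = {e, f, g}"
    using incident_T(1)[OF assms(2)] c(2) by simp
  have "e \<in> incident S u" "f \<in> incident S u" "g \<in> incident S u"
    unfolding inc by simp_all
  then have E: "e \<in> edges S" "f \<in> edges S" "g \<in> edges S"
    by (simp_all add: incident_def)
  have "v \<notin> e" "v \<notin> f" "v \<notin> g"
    using edge_S_at_v[OF E(1)] edge_S_at_v[OF E(2)] edge_S_at_v[OF E(3)] initial_labels_T(3) c(3,4)
      assms(3) by auto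
  then have "Some a = map_option up (leaf_edge_labeling S e)"
    "Some b = map_option up (leaf_edge_labeling S f)" "None = map_option up (leaf_edge_labeling S g)"
    using initial_label_lift[OF E(1)] initial_label_lift[OF E(2)] initial_label_lift[OF E(3)] c(3,4,6)
    by simp_all
  then obtain a' b' where "a = up a'" "b = up b'" "leaf_edge_labeling S e = Some a'"
    "leaf_edge_labeling S f = Some b'" "leaf_edge_labeling S g = None"
    by (cases "leaf_edge_labeling S e"; cases "leaf_edge_labeling S f") auto
  then show thesis
    using that inc u(3) c(5) by (simp add: can_compete_def)
qed

text \<open>
  The neck edge is the only edge of \<open>S\<close> at the leaf \<open>v\<close>, so a cherry of \<open>S\<close> that involves \<open>v\<close>
  sits at the neck.
\<close>
lemma compete_at_neck:
  assumes "can_compete S (leaf_edge_labeling S) u e f g a b"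
  shows "v \<in> e \<Longrightarrow> a = label S v \<and> (\<exists>z\<in>leaves S. z \<noteq> v \<and> {neck, z} \<in> edges S \<and> label S z = b)"
    and "v \<in> f \<Longrightarrow> b = label S v \<and> (\<exists>z\<in>leaves S. z \<noteq> v \<and> {neck, z} \<in> edges S \<and> label S z = a)"
proof -
  obtain p q where pq: "p \<in> leaves S" "q \<in> leaves S" "p \<noteq> q" "e = {u, p}" "f = {u, q}"
    "e \<in> edges S" "f \<in> edges S" "u \<notin> leaves S" "label S p = a" "label S q = b"
    using initial_competitors[OF trivalent_S assms] by metis
  have "u \<noteq> v" using pq(8) graft_facts(1) by blast
  show "v \<in> e \<Longrightarrow> a = label S v \<and> (\<exists>z\<in>leaves S. z \<noteq> v \<and> {neck, z} \<in> edges S \<and> label S z = b)"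
  proof -
    assume "v \<in> e"
    then have "p = v" "e = neck_edge" using pq(4) \<open>u \<noteq> v\<close> edge_S_at_v[OF pq(6)] by auto
    moreover have "u = neck"
      using calculation pq(4) by (auto simp: doubleton_eq_iff)
    ultimately show ?thesis using pq by (intro conjI bexI[of _ q]) auto
  qed
  show "v \<in> f \<Longrightarrow> b = label S v \<and> (\<exists>z\<in>leaves S. z \<noteq> v \<and> {neck, z} \<in> edges S \<and> label S z = a)"
  proof -
    assume "v \<in> f"
    then have "q = v" "f = neck_edge" using pq(5) \<open>u \<noteq> v\<close> edge_S_at_v[OF pq(7)] by auto
    moreover have "u = neck"
      using calculation pq(5) by (auto simp: doubleton_eq_iff)
    ultimately show ?thesis using pq by (intro conjI bexI[of _ p]) auto
  qed
qed

lemma neck_competition: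
  assumes "S \<in> labeled_trees n" "1 \<le> n" "z \<in> leaves S" "z \<noteq> v" "{neck, z} \<in> edges S"
  obtains e f g where
    "can_compete S (leaf_edge_labeling S) neck e f g (min (label S v) (label S z)) (max (label S v) (label S z))"
proof -
  obtain w where w: "{neck, w} \<in> edges S" "w \<notin> leaves S"
    using inner_edge_exists[OF assms(1,2) neck(5,6)] .
  have "label S v \<noteq> label S z"
    using inj_onD[OF labeled_treesD(2)[OF assms(1)], of v z] assms(3,4) graft_facts(1) by blast
  then consider "label S v < label S z" | "label S z < label S v" by linarith
  moreover have "{neck, v} \<in> edges S" using neck(1) by (simp add: insert_commute)
  ultimately show thesis
  proof cases
    case 1
    from cherry_can_compete[OF trivalent_S graft_facts(1) assms(3) \<open>{neck, v} \<in> edges S\<close> assms(5) 1 w]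
    show thesis using that 1 by (simp add: min_def max_def)
  next
    case 2
    from cherry_can_compete[OF trivalent_S assms(3) graft_facts(1) assms(5) \<open>{neck, v} \<in> edges S\<close> 2 w]
    show thesis using that 2 by (simp add: min_def max_def)
  qed
qed

lemma advancing_cases: "advancing T L g i j = i \<or> advancing T L g i j = j"
  by (simp add: advancing_def)

text \<open>
  Initially the only labeled edges that meet the neck edge, apart from those of the cherry,
  are leaf edges at the neck.
\<close>
lemma lazy_iff:
  assumes "inj_on (label T) (leaves T)"
  shows "advancing T (leaf_edge_labeling T) neck_edge i j = i \<longleftrightarrow>
    (\<exists>z\<in>leaves S. z \<noteq> v \<and> {neck, z} \<in> edges S \<and> i < up (label S z))"
proof -
  let ?L = "leaf_edge_labeling T"
  have "advancing T ?L neck_edge i j = i \<longleftrightarrow>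
      (\<exists>h\<in>edges T. h \<noteq> neck_edge \<and> h \<inter> neck_edge \<noteq> {} \<and> (\<exists>u. ?L h = Some u \<and> u \<noteq> j \<and> u > i))"
    using loser_less by (simp add: advancing_def)
  also have "\<dots> \<longleftrightarrow> (\<exists>z\<in>leaves S. z \<noteq> v \<and> {neck, z} \<in> edges S \<and> i < up (label S z))"
  proof
    assume "\<exists>h\<in>edges T. h \<noteq> neck_edge \<and> h \<inter> neck_edge \<noteq> {} \<and> (\<exists>u. ?L h = Some u \<and> u \<noteq> j \<and> u > i)"
    then obtain h u where h: "h \<in> edges T" "h \<noteq> neck_edge" "h \<inter> neck_edge \<noteq> {}" "?L h = Some u"
      "u \<noteq> j" "u > i" by blast
    have "h \<noteq> {v, x}" "h \<noteq> {v, y}"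
      using h(4-6) initial_labels_T by auto
    then have hS: "h \<in> edges S" using h(1) graft_facts(7) by blast
    then have "v \<notin> h" using edge_S_at_v h(2) by blast
    then have "neck \<in> h" using h(3) by blast
    obtain z where z: "z \<in> leaves T" "z \<in> h" "label T z = u"
      using leaf_edge_labeling_SomeE[OF trivalent_T h(4)] by metis
    obtain z' where "h = {neck, z'}"
      using edge_through[OF graph_S hS \<open>neck \<in> h\<close>] by metis
    then have "h = {neck, z}" using z(1,2) neck(7) by auto
    moreover have "z \<in> leaves S" "z \<noteq> v"
      using z(1,2) leaves_T edge_S_avoids[OF hS] \<open>v \<notin> h\<close> by auto
    ultimately show "\<exists>z\<in>leaves S. z \<noteq> v \<and> {neck, z} \<in> edges S \<and> i < up (label S z)"
      using hS z(3) h(6) label_other by auto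
  next
    assume "\<exists>z\<in>leaves S. z \<noteq> v \<and> {neck, z} \<in> edges S \<and> i < up (label S z)"
    then obtain z where z: "z \<in> leaves S" "z \<noteq> v" "{neck, z} \<in> edges S" "i < up (label S z)" by blast
    have zT: "z \<in> leaves T" "z \<noteq> y" "{neck, z} \<in> edges T"
      using z graft_facts leaves_T by (auto simp: leaves_def)
    have "label T z \<noteq> j"
      using inj_onD[OF assms, of z y] zT(1,2) graft_facts(10) label_y by auto
    moreover have "?L {neck, z} = Some (label T z)"
      using leaf_edge_labeling_leaf[OF trivalent_T zT(1,3)] by simp
    moreover have "{neck, z} \<noteq> neck_edge"
      using z(2) neck(2) by (auto simp: doubleton_eq_iff)
    ultimately show "\<exists>h\<in>edges T. h \<noteq> neck_edge \<and> h \<inter> neck_edge \<noteq> {} \<and>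
        (\<exists>u. ?L h = Some u \<and> u \<noteq> j \<and> u > i)"
      using zT(3) z(4) label_other[OF z(1,2)] by (intro bexI[of _ "{neck, z}"]) auto
  qed
  finally show ?thesis .
qed

text \<open>
  A cherry of \<open>S\<close> away from \<open>v\<close> is one of \<open>T\<close>, so its loser is less than \<open>i\<close>. A cherry of \<open>S\<close>
  at the neck pairs \<open>j\<close> with a leaf which is less than \<open>i\<close>, as otherwise \<open>i\<close> would have
  advanced.
\<close>
lemma first_loser_S_winner_advances:
  assumes inj: "inj_on (label T) (leaves T)"
    and first: "face_off T (leaf_edge_labeling T) v {v, x} {v, y} neck_edge i j"
    and "m = i" "advancing T (leaf_edge_labeling T) neck_edge i j = j"
    and S: "face_off S (leaf_edge_labeling S) u e f g a b"
  shows "a < i"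
proof -
  have c: "can_compete S (leaf_edge_labeling S) u e f g a b" "a < b"
    using S by (simp_all add: face_off_def can_compete_def)
  have v: "up (label S v) = j"
    using stump assms(3) loser_less by auto
  have not_lazy: "\<not> i < up (label S z)" if "z \<in> leaves S" "z \<noteq> v" "{neck, z} \<in> edges S" for z
    using lazy_iff[OF inj] assms(4) loser_less that by auto
  \<comment> \<open>A larger label next to \<open>j\<close> also exceeds \<open>i\<close>, which laziness excludes.\<close>
  have "v \<notin> e"
  proof
    assume "v \<in> e"
    then obtain z where "z \<in> leaves S" "z \<noteq> v" "{neck, z} \<in> edges S" "label S z = b" "a = label S v"
      using compete_at_neck(1)[OF c(1)] by blast
    then have "up b \<le> i" "up a = j" using not_lazy[of z] v by auto
    moreover have "up a < up b" using c(2) by simp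
    ultimately show False using loser_less by linarith
  qed
  have "up a \<le> i"
  proof (cases "v \<in> f")
    case True
    then show ?thesis using compete_at_neck(2)[OF c(1)] not_lazy by fastforce
  next
    case False
    then show ?thesis
      using initial_compete_S_to_T[OF c(1) \<open>v \<notin> e\<close>] first unfolding face_off_def by blast
  qed
  moreover have "up a \<noteq> i" using assms(3) by auto
  moreover have "a \<le> up a" by (simp add: increase_from_def)
  ultimately show ?thesis by linarith
qed

text \<open>
  Laziness puts \<open>i\<close> next to a larger label, so it can lose again; no cherry of \<open>S\<close> has a
  larger loser.
\<close>
lemma first_loser_S_loser_advances:
  assumes inj: "inj_on (label T) (leaves T)"
    and first: "face_off T (leaf_edge_labeling T) v {v, x} {v, y} neck_edge i j"
    and "m = j" "advancing T (leaf_edge_labeling T) neck_edge i j = i"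
    and "S \<in> labeled_trees n" "1 \<le> n"
    and S: "face_off S (leaf_edge_labeling S) u e f g a b"
  shows "a = i"
proof -
  have c: "can_compete S (leaf_edge_labeling S) u e f g a b" "a < b"
    using S by (simp_all add: face_off_def can_compete_def)
  have up_v: "up (label S v) = i"
    using stump assms(3) loser_less by auto
  then have v: "label S v = i"
    using assms(3) loser_less by (auto simp: increase_from_def split: if_splits)
  have "a \<le> i"
  proof -
    consider "v \<in> e" | "v \<in> f" | "v \<notin> e" "v \<notin> f" by blast
    then show ?thesis
    proof cases
      case 1
      then show ?thesis using compete_at_neck(1)[OF c(1)] v by auto
    next
      case 2
      then show ?thesis using compete_at_neck(2)[OF c(1)] v c(2) by auto
    next
      case 3
      then have "up a \<le> i"
        using initial_compete_S_to_T[OF c(1)] first unfolding face_off_def by blast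
      then show ?thesis by (simp add: increase_from_def split: if_splits)
    qed
  qed
  moreover have "i \<le> a"
  proof -
    obtain z where z: "z \<in> leaves S" "z \<noteq> v" "{neck, z} \<in> edges S" "i < up (label S z)"
      using lazy_iff[OF inj] assms(4) by blast
    have "up (label S v) < up (label S z)" using z(4) up_v by simp
    then have "min (label S v) (label S z) = i" using v by simp
    then show ?thesis
      using neck_competition[OF assms(5,6) z(1-3)] S unfolding face_off_def by metis
  qed
  ultimately show ?thesis by simp
qed

text \<open>
  Given the first loser of \<open>S\<close>, the first round of \<open>T\<close> is as required. The loser \<open>i\<close> of the
  new cherry beats the bound for the other cherries, and the leaf at the neck, if there is
  one, decides who advances: when \<open>j\<close> is to advance, a label above \<open>i\<close> there would give \<open>S\<close> a
  cherry whose loser is at least \<open>i\<close>; when \<open>i\<close> is to advance, the opponent of \<open>i\<close> in the first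
  face-off of \<open>S\<close> is a larger label at the neck.
\<close>
lemma first_face_off_T:
  assumes S: "S \<in> labeled_trees n" "1 \<le> n" and inj: "inj_on (label T) (leaves T)"
    and fS: "face_off S (leaf_edge_labeling S) u e f g a b"
    and a: "m = i \<Longrightarrow> a < i" "m = j \<Longrightarrow> a = i"
  shows "face_off T (leaf_edge_labeling T) v {v, x} {v, y} neck_edge i j"
    and "advancing T (leaf_edge_labeling T) neck_edge i j = up (label S v)"
proof -
  have cS: "can_compete S (leaf_edge_labeling S) u e f g a b" "a < b"
    using fS by (simp_all add: face_off_def can_compete_def)
  show "face_off T (leaf_edge_labeling T) v {v, x} {v, y} neck_edge i j"
    unfolding face_off_def
  proof (intro conjI allI impI)
    show "can_compete T (leaf_edge_labeling T) v {v, x} {v, y} neck_edge i j"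
      using incident_T_v initial_labels_T graft_facts loser_less by (simp add: can_compete_def)
    fix u' e' f' g' a' b'
    assume c: "can_compete T (leaf_edge_labeling T) u' e' f' g' a' b'"
    show "a' \<le> i"
    proof (cases "u' = v")
      case True
      have "e' \<in> incident T v" "f' \<in> incident T v"
        using c True by (simp_all add: can_compete_def)
      then have "a' = i \<or> a' = j" "b' = i \<or> b' = j"
        unfolding incident_T_v using c initial_labels_T by (auto simp: can_compete_def)
      moreover have "a' < b'" using c by (simp add: can_compete_def)
      ultimately show ?thesis using loser_less by auto
    next
      case False
      \<comment> \<open>Otherwise both other edges at the neck would be leaf edges, and \<open>S\<close> would be a star.\<close>
      have "g' \<noteq> neck_edge"
      proof
        assume g': "g' = neck_edge"
        obtain p q w where pq: "p \<in> leaves T" "q \<in> leaves T" "e' = {u', p}" "f' = {u', q}"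
          "g' = {u', w}" "e' \<in> edges T" "f' \<in> edges T" "u' \<notin> leaves T"
          using initial_competitors[OF trivalent_T c] by metis
        have "u' = neck" using pq(5) g' False by (auto simp: doubleton_eq_iff)
        then have inc: "incident S neck = {{neck, p}, {neck, q}, neck_edge}"
          using c incident_T(1)[OF neck(2-4)] pq g' by (simp add: can_compete_def)
        have "p \<in> leaves S" "q \<in> leaves S"
          using inc pq(1,2) leaves_T edge_S_avoids[of "{neck, p}"] edge_S_avoids[of "{neck, q}"]
          unfolding incident_def by blast+
        moreover obtain w where w: "{neck, w} \<in> edges S" "w \<notin> leaves S"
          using inner_edge_exists[OF S neck(5,6)] .
        have "{neck, w} \<in> incident S neck" using w by (simp add: incident_def)
        then have "w = p \<or> w = q \<or> w = v"
          unfolding inc by (auto simp: doubleton_eq_iff)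
        ultimately show False using w(2) graft_facts(1) by blast
      qed
      then obtain a'' b'' where "a' = up a''" "can_compete S (leaf_edge_labeling S) u' e' f' g' a'' b''"
        using initial_compete_T_to_S[OF c False] by metis
      moreover from this have "a'' \<le> a" using fS unfolding face_off_def by blast
      ultimately show ?thesis
        using a stump loser_less by (auto simp: increase_from_def)
    qed
  qed
  show "advancing T (leaf_edge_labeling T) neck_edge i j = up (label S v)"
    using stump
  proof (elim disjE conjE)
    assume m: "m = i" "up (label S v) = j"
    have "\<not> i < up (label S z)" if z: "z \<in> leaves S" "z \<noteq> v" "{neck, z} \<in> edges S" for z
    proof -
      have "min (label S v) (label S z) \<le> a"
        using neck_competition[OF S z] fS unfolding face_off_def by metis
      moreover have "i \<le> label S v"
        using m loser_less by (auto simp: increase_from_def split: if_splits)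
      ultimately have "label S z < i" using a(1) m(1) by (simp add: min_def split: if_splits)
      then show ?thesis using m(1) by (simp add: increase_from_def)
    qed
    then show ?thesis using lazy_iff[OF inj] advancing_cases m(2) by metis
  next
    assume m: "m = j" "up (label S v) = i"
    then have v: "label S v = a"
      using a(2) loser_less by (auto simp: increase_from_def split: if_splits)
    obtain p where p: "p \<in> leaves S" "p \<in> e" "label S p = a"
      using initial_competitors[OF trivalent_S cS(1)] by (metis insertI1 insert_commute)
    then have "v \<in> e"
      using inj_onD[OF labeled_treesD(2)[OF S(1)], of p v] v graft_facts(1) by auto
    then obtain z where z: "z \<in> leaves S" "z \<noteq> v" "{neck, z} \<in> edges S" "label S z = b"
      using compete_at_neck(1)[OF cS(1)] by blast
    have "i < up (label S z)" using z(4) cS(2) a(2) m(1) by (simp add: increase_from_def)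
    then show ?thesis using lazy_iff[OF inj] z m(2) by auto
  qed
qed

end

text \<open>
  The tree that \<^const>\<open>pi_lazy_tree\<close> produces, for any choice of the removed label \<open>m\<close> and the
  label \<open>a\<close> put on \<open>v\<close>. Choosing them by who advances gives the induction for
  \<open>first_face_off_of_tour\<close>; choosing them by \<open>k\<close> gives the map.
\<close>
definition prune :: "tree \<Rightarrow> nat \<Rightarrow> nat \<Rightarrow> nat \<Rightarrow> int \<Rightarrow> int \<Rightarrow> tree" where
  "prune T v x y m a = \<lparr>verts = verts T - {x, y}, edges = edges T - {{v, x}, {v, y}},
     label = decrease_above m \<circ> (label T)(v := a)\<rparr>"

lemma face_off_cherry:
  assumes T: "T \<in> labeled_trees n" and "face_off T (leaf_edge_labeling T) v e f g i j"
    and ma: "m = i \<and> a = j \<or> m = j \<and> a = i"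
  obtains x y where "cherry_removal T (prune T v x y m a) v x y i j m" "e = {v, x}" "f = {v, y}"
    "g = {v, cherry_removal.neck (prune T v x y m a) v}"
    "{z \<in> leaves T. label T z = i \<or> label T z = j} = {x, y}"
proof -
  note TD = labeled_treesD[OF T]
  have c: "can_compete T (leaf_edge_labeling T) v e f g i j" "i < j"
    using assms(2) by (simp_all add: face_off_def can_compete_def)
  obtain x y w where xy: "x \<in> leaves T" "y \<in> leaves T" "x \<noteq> y" "e = {v, x}" "f = {v, y}"
    "g = {v, w}" "e \<in> edges T" "f \<in> edges T" "g \<in> edges T" "w \<notin> leaves T"
    "label T x = i" "label T y = j" "v \<notin> leaves T"
    using initial_competitors[OF TD(1) c(1)] by metis
  let ?S = "prune T v x y m a"
  have pr: "trivalent ?S" "grafted ?S T v x y"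
    using pruned_trivalent[OF TD(1) xy(3,1,2), of v w ?S] xy by (simp_all add: prune_def)
  have labels: "z = x \<or> z = y" if "z \<in> leaves T" "label T z = i \<or> label T z = j" for z
    using that inj_onD[OF TD(2), of z x] inj_onD[OF TD(2), of z y] xy by auto
  have leaves: "leaves T = (leaves ?S - {v}) \<union> {x, y}" "x \<notin> leaves ?S" "y \<notin> leaves ?S"
    using grafted_leaves[OF pr(2) trivalentD(1)[OF pr(1)]] by (auto simp: leaves_def prune_def)
  have cr: "cherry_removal T ?S v x y i j m"
  proof
    show "m = i \<and> increase_from m (label ?S v) = j \<or> m = j \<and> increase_from m (label ?S v) = i"
      using ma c(2) increase_decrease[of a m] by (auto simp: prune_def)
    fix z assume z: "z \<in> leaves ?S" "z \<noteq> v"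
    then have "z \<in> leaves T" "z \<noteq> x" "z \<noteq> y" using leaves by auto
    then have "label T z \<noteq> m" using labels ma by auto
    then show "label T z = increase_from m (label ?S z)"
      using increase_decrease[of "label T z" m] z(2) by (simp add: prune_def)
  qed (use pr xy c(2) in auto)
  interpret cherry_removal T ?S v x y i j m by (rule cr)
  have "leaf_edge_labeling T g = None" using c(1) by (simp add: can_compete_def)
  then have "g \<noteq> e" "g \<noteq> f"
    using xy initial_labels_T by auto
  then have "g = neck_edge"
    using xy edge_S_at_v[of g] by (simp add: prune_def)
  moreover have "{z \<in> leaves T. label T z = i \<or> label T z = j} = {x, y}"
    using labels xy by auto
  ultimately show thesis using that[of x y] cr xy by blast
qed

text \<open>
  Induction through the tree whose new leaf carries the label that advances. Its first loser
  is the rightmost zero of the remaining wins, and is less than \<open>i\<close> or equal to \<open>i\<close> according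
  to whether \<open>j\<close> or \<open>i\<close> advances. For \<open>n = 1\<close> the label \<open>1\<close> advances in spite of \<open>k\<^sub>1 = 1\<close>,
  whence the restriction in the last part.
\<close>
lemma first_face_off_of_tour:
  assumes "1 \<le> n" "weak_composition n k" "T \<in> tour_trees k"
    and "face_off T (leaf_edge_labeling T) v e f g i j"
  shows "i = rightmost_zero k" "j \<le> int n"
    "2 \<le> n \<Longrightarrow> advancing T (leaf_edge_labeling T) g i j = (if 1 < entry k j then j else i)"
proof -
  have "i = rightmost_zero k \<and> j \<le> int n \<and>
    (2 \<le> n \<longrightarrow> advancing T (leaf_edge_labeling T) g i j = (if 1 < entry k j then j else i))"
    using assms
  proof (induction n arbitrary: k T v e f g i j)
    case (Suc N)
    note w = Suc.prems(2) and T = Suc.prems(3) and first = Suc.prems(4)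
    have len: "length k = Suc N" using w by (simp add: weak_composition_def)
    have Tn: "T \<in> labeled_trees (Suc N)" "ab_cherry T"
      using T len by (simp_all add: tour_trees_iff)
    note TD = labeled_treesD[OF Tn(1)]
    have i: "0 \<le> i" using first_loser_nonneg[OF Tn _ first] by simp
    have ij: "i < j" using first by (simp add: face_off_def can_compete_def)
    \<comment> \<open>At this point only who advances is known, not yet how this is related to \<open>k\<close>.\<close>
    define m where "m = (if advancing T (leaf_edge_labeling T) g i j = j then i else j)"
    define a where "a = (if advancing T (leaf_edge_labeling T) g i j = j then j else i)"
    have ma: "m = i \<and> a = j \<or> m = j \<and> a = i" by (simp add: m_def a_def)
    obtain x y where cr: "cherry_removal T (prune T v x y m a) v x y i j m"
      and efg: "e = {v, x}" "f = {v, y}" "g = {v, cherry_removal.neck (prune T v x y m a) v}"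
      by (rule face_off_cherry[OF Tn(1) first ma])
    define S where "S = prune T v x y m a"
    interpret cherry_removal T S v x y i j m using cr by (simp add: S_def)
    have g: "g = neck_edge" using efg(3) by (simp add: S_def)
    have first': "face_off T (leaf_edge_labeling T) v {v, x} {v, y} neck_edge i j"
      using first efg g by simp
    have adv: "advancing T (leaf_edge_labeling T) neck_edge i j = up (label S v)"
      using advancing_cases[of "leaf_edge_labeling T" neck_edge] stump loser_less
      unfolding m_def g[symmetric] by auto
    have j: "j \<le> int (Suc N)" "m \<le> int (Suc N)" "0 \<le> m"
      using TD(4)[OF graft_facts(10)] label_y i ij stump by auto
    show ?case
    proof (cases "N = 0")
      case True
      then have k: "k = [1]"
        using w by (cases k) (auto simp: weak_composition_def)
      have "i = 0" using i ij j(1) True by simp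
      then show ?thesis
        using rightmost_zero_eqI[OF w, of 0] j True k by (auto simp: entry_def)
    next
      case False
      then have N: "1 \<le> N" by simp
      have Sn: "S \<in> labeled_trees N" "ab_cherry S"
        using labeled_iff[of "Suc N"] Tn j ab_cherry_iff[OF i] by simp_all
      obtain L rs where "lazy_tournament T L rs"
        using T by (auto simp: tour_trees_iff)
      then obtain L' rs' where "lazy_tournament S L' rs'"
        using lazy_tournament_T_to_S[OF first' adv TD(2)] by metis
      then obtain u e' f' g' i' j' where S1: "face_off S (leaf_edge_labeling S) u e' f' g' i' j'"
        using first_face_off_exists[OF Sn(1) N] by metis
      have i': "0 \<le> i'" using first_loser_nonneg[OF Sn N S1] .
      \<comment> \<open>The removed label is not \<open>c\<close>: otherwise \<open>c\<close> lost and \<open>j\<close> advanced, so \<open>a\<close> or \<open>b\<close> would lose first in \<open>S\<close>.\<close>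
      have m: "1 \<le> m" and less: "m = i \<Longrightarrow> i' < i"
      proof -
        show less: "i' < i" if "m = i"
        proof -
          have "advancing T (leaf_edge_labeling T) neck_edge i j = j"
            using that ij unfolding m_def g by (auto split: if_splits)
          then show ?thesis using first_loser_S_winner_advances[OF TD(2) first' that _ S1] by simp
        qed
        show "1 \<le> m" using less i' i ij stump by force
      qed
      note tour = tour_T_to_S[OF first' adv i m T]
      have j1: "1 \<le> j" using i ij by simp
      have w': "weak_composition N (play_round k j m)"
        using play_round_props(3)[OF len j1 j(1) m j(2) tour(2) w tour(3)] by simp
      have IH: "i' = rightmost_zero (play_round k j m)"
        using Suc.IH[OF N w' tour(1) S1] by blast
      show ?thesis
      proof (cases "m = i")
        case True
        then have "rightmost_zero k = i" "1 < entry k j"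
          using rightmost_zero_raise[OF w j1 j(1) _ ij tour(2)] m tour(3) ij less IH by auto
        moreover have "advancing T (leaf_edge_labeling T) g i j = j"
          using True ij unfolding m_def by (auto split: if_splits)
        ultimately show ?thesis using j by simp
      next
        case False
        then have mj: "m = j" using stump by blast
        have adv_i: "advancing T (leaf_edge_labeling T) g i j = i"
          using False advancing_cases[of "leaf_edge_labeling T" g] by (auto simp: m_def)
        then have "i' = i"
          using first_loser_S_loser_advances[OF TD(2) first' mj _ Sn(1) N S1] g by simp
        moreover have "entry k j = 1" using tour(3) mj by simp
        ultimately have "rightmost_zero k = i"
          using rightmost_zero_keep[OF w j1 j(1) i ij] IH mj by simp
        then show ?thesis using adv_i j \<open>entry k j = 1\<close> by simp
      qed
    qed
  qed simp
  then show "i = rightmost_zero k" "j \<le> int n"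
    "2 \<le> n \<Longrightarrow> advancing T (leaf_edge_labeling T) g i j = (if 1 < entry k j then j else i)"
    by auto
qed

section \<open>The map on isomorphism classes\<close>

lemma pi_lazy_tree_cherry:
  assumes T: "T \<in> labeled_trees n" and first: "face_off T (leaf_edge_labeling T) v e f g i j"
  obtains x y S where "pi_lazy_tree k T = (j, S)"
    "cherry_removal T S v x y i j (if 1 < entry k j then i else j)" "e = {v, x}" "f = {v, y}"
    "g = {v, cherry_removal.neck S v}"
proof -
  define m where "m = (if 1 < entry k j then i else j)"
  define a where "a = (if 1 < entry k j then j else i)"
  have ma: "m = i \<and> a = j \<or> m = j \<and> a = i" by (simp add: m_def a_def)
  obtain x y where c: "cherry_removal T (prune T v x y m a) v x y i j m" "e = {v, x}" "f = {v, y}"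
    "g = {v, cherry_removal.neck (prune T v x y m a) v}"
    "{z \<in> leaves T. label T z = i \<or> label T z = j} = {x, y}"
    by (rule face_off_cherry[OF T first ma])
  have "first_face_off T = (v, e, f, i, j)"
    using first_face_off_eq[OF labeled_treesD(1,2)[OF T] first] .
  then have "pi_lazy_tree k T = (j, prune T v x y m a)"
    using c(2,3,5) by (simp add: pi_lazy_tree_def prune_def m_def a_def)
  then show thesis using that c(1-4) unfolding m_def by blast
qed

lemma tour_trees_empty:
  assumes "S \<in> labeled_trees 0" "ab_cherry S" "length k = 0"
  shows "S \<in> tour_trees k"
proof -
  have "lazy_tournament S (leaf_edge_labeling S) []"
    using no_inner_edge[OF assms(1,2)] lazy_rounds.start by (simp add: lazy_tournament_def)
  then show ?thesis using assms by (auto simp: tour_trees_iff)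
qed

text \<open>
  For \<open>n \<ge> 2\<close> the label put on \<open>v\<close> is the one that advances. For \<open>n = 1\<close> it need not be, but
  then \<open>S\<close> is a star, and its tournament has no rounds.
\<close>
lemma pi_lazy_tree_tour:
  assumes n: "1 \<le> n" and w: "weak_composition n k" and T: "T \<in> tour_trees k"
  obtains S v x y g j where "pi_lazy_tree k T = (j, S)" "rightmost_zero k < j" "j \<le> int n"
    "cherry_removal T S v x y (rightmost_zero k) j (removed_label k j)"
    "face_off T (leaf_edge_labeling T) v {v, x} {v, y} g (rightmost_zero k) j"
    "S \<in> tour_trees (tilde k j)" "S \<in> labeled_trees (n - 1)"
proof -
  have len: "length k = n" using w by (simp add: weak_composition_def)
  have Tn: "T \<in> labeled_trees n" "ab_cherry T"
    using T len by (simp_all add: tour_trees_iff)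
  obtain L rs where "lazy_tournament T L rs" using T by (auto simp: tour_trees_iff)
  then obtain v e f g i j where first: "face_off T (leaf_edge_labeling T) v e f g i j"
    using first_face_off_exists[OF Tn(1) n] by metis
  note key = first_face_off_of_tour[OF n w T first]
  have ij: "i < j" using first by (simp add: face_off_def can_compete_def)
  have i: "0 \<le> i" using key(1) rightmost_zero_props(1)[OF w] by simp
  obtain x y S where S: "pi_lazy_tree k T = (j, S)"
    "cherry_removal T S v x y i j (if 1 < entry k j then i else j)" "e = {v, x}" "f = {v, y}"
    "g = {v, cherry_removal.neck S v}"
    by (rule pi_lazy_tree_cherry[OF Tn(1) first])
  have m: "removed_label k j = (if 1 < entry k j then i else j)"
    using key(1) by (simp add: removed_label_def)
  interpret cherry_removal T S v x y i j "removed_label k j" using S(2) m by simp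
  have j: "1 \<le> j" "rightmost_zero k < j" using ij i key(1) by auto
  note rl = removed_label_props[OF w j(1) key(2) j(2)]
  have Sn: "S \<in> labeled_trees (n - 1)"
    using labeled_iff[OF n _ rl(2)] rl(1) Tn(1) by simp
  have first': "face_off T (leaf_edge_labeling T) v {v, x} {v, y} neck_edge i j"
    using first S(3-5) by simp
  have "S \<in> tour_trees (tilde k j)"
  proof (cases "n = 1")
    case True
    then show ?thesis
      using tour_trees_empty[of S] Sn ab_cherry_iff[OF i] Tn(2) rightmost_zero_tilde(1)[OF w j(1) key(2) j(2)]
      by (simp add: weak_composition_def)
  next
    case False
    then have "advancing T (leaf_edge_labeling T) neck_edge i j = (if 1 < entry k j then j else i)"
      using key(3) n S(5) by simp
    then have "advancing T (leaf_edge_labeling T) neck_edge i j = up (label S v)"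
      using stump m ij by (auto split: if_splits)
    then show ?thesis
      using tour_T_to_S(1)[OF first' _ i rl(1) T] rl(4) by simp
  qed
  then show thesis
    using that[of j S v x y neck_edge] S(1) j key(1,2) cherry_removal_axioms first' Sn by simp
qed

text \<open>
  The first face-off is transported by an isomorphism, and the label removed depends on it and
  \<open>k\<close> only.
\<close>
lemma pi_lazy_tree_isomorphic:
  assumes n: "1 \<le> n" and w: "weak_composition n k" and T: "T \<in> tour_trees k"
    and iso: "(T, T') \<in> tree_iso n" and pi: "pi_lazy_tree k T = (j, S)"
  obtains S' where "pi_lazy_tree k T' = (j, S')" "(S, S') \<in> tree_iso (n - 1)"
proof -
  let ?i = "rightmost_zero k"
  have T': "T \<in> labeled_trees n" "T' \<in> labeled_trees n" "isomorphic T T'"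
    using iso by (simp_all add: tree_iso_def)
  obtain v x y g where A: "?i < j" "j \<le> int n" "cherry_removal T S v x y ?i j (removed_label k j)"
    "face_off T (leaf_edge_labeling T) v {v, x} {v, y} g ?i j" "S \<in> labeled_trees (n - 1)"
    using pi_lazy_tree_tour[OF n w T] pi by (metis Pair_inject)
  obtain f where f: "iso_map f T T'" using T'(3) by (auto simp: isomorphic_iff)
  obtain x' y' S' where S': "pi_lazy_tree k T' = (j, S')"
    "cherry_removal T' S' (f v) x' y' ?i j (if 1 < entry k j then ?i else j)"
    by (rule pi_lazy_tree_cherry[OF T'(2)
      iso_map_face_off[OF f labeled_treesD(1)[OF T'(1)] labeled_treesD(1)[OF T'(2)] A(4)]])
  interpret cherry_removal T' S' "f v" x' y' ?i j "removed_label k j"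
    using S'(2) by (simp add: removed_label_def)
  have "1 \<le> j" using A(1) rightmost_zero_props(1)[OF w] by simp
  note rl = removed_label_props[OF w this A(2,1)]
  have "S' \<in> labeled_trees (n - 1)"
    using labeled_iff[OF n _ rl(2)] rl(1) T'(2) by simp
  moreover have "isomorphic S S'"
    using isomorphic_remove_cherries[OF A(3) cherry_removal_axioms labeled_treesD(2)[OF T'(2)] T'(3)] .
  ultimately show thesis using that S'(1) A(5) by (simp add: tree_iso_def)
qed

lemma pi_lazy_class:
  assumes n: "1 \<le> n" and w: "weak_composition n k" and T: "T \<in> tour_trees k"
    and pi: "pi_lazy_tree k T = (j, S)"
  shows "pi_lazy k (tree_iso n `` {T}) = (j, tree_iso (n - 1) `` {S})"
proof -
  have len: "length k = n" using w by (simp add: weak_composition_def)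
  let ?h = "\<lambda>T. case pi_lazy_tree k T of (j, S) \<Rightarrow> (j, tree_iso (length k - 1) `` {S})"
  have "?h T' = (j, tree_iso (n - 1) `` {S})" if T': "(T, T') \<in> tree_iso n" for T'
  proof -
    obtain S' where "pi_lazy_tree k T' = (j, S')" "(S, S') \<in> tree_iso (n - 1)"
      using pi_lazy_tree_isomorphic[OF n w T T' pi] .
    then show ?thesis
      using equiv_class_eq[OF equiv_tree_iso, of S S'] len by simp
  qed
  moreover have "(T, T) \<in> tree_iso n"
    using equiv_class_self[OF equiv_tree_iso, of T n] T len by (simp add: tour_trees_iff)
  ultimately have "?h ` (tree_iso n `` {T}) = {(j, tree_iso (n - 1) `` {S})}"
    by (intro equalityI subsetI) (auto simp: image_iff)
  then show ?thesis by (simp add: pi_lazy_def)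
qed

text \<open>Vertices are natural numbers, so there are always two unused ones for the new leaves.\<close>
lemma graft_exists:
  assumes S: "S \<in> labeled_trees n" and l: "l \<in> {-2..int n}" "i < j"
    and m: "m = i \<and> increase_from m l = j \<or> m = j \<and> increase_from m l = i"
  obtains T v x y where "cherry_removal T S v x y i j m"
proof -
  note SD = labeled_treesD[OF S]
  obtain v where v: "v \<in> leaves S" "label S v = l"
    using SD(3) l(1) by (metis imageE)
  have "finite (verts S)"
    using trivalentD(1)[OF SD(1)] by (simp add: finite_simple_graph_def)
  then obtain x where x: "x \<notin> verts S"
    using ex_new_if_finite[OF infinite_UNIV_nat] by blast
  obtain y where y: "y \<notin> insert x (verts S)"
    using ex_new_if_finite[OF infinite_UNIV_nat, of "insert x (verts S)"] \<open>finite (verts S)\<close> by blast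
  define T where "T = \<lparr>verts = verts S \<union> {x, y}, edges = edges S \<union> {{v, x}, {v, y}},
    label = (\<lambda>z. increase_from m (label S z))(x := i, y := j)\<rparr>"
  have "cherry_removal T S v x y i j m"
  proof
    show "grafted S T v x y"
      using v x y by (auto simp: grafted_def T_def)
    show "label T z = increase_from m (label S z)" if "z \<in> leaves S" for z
      using that x y by (auto simp: T_def leaves_def)
  qed (use SD(1) v l m x y in \<open>auto simp: T_def\<close>)
  then show thesis using that by blast
qed

text \<open>
  With the leaves \<open>a\<close>, \<open>b\<close>, \<open>c\<close>, \<open>1\<close> there is a single inner edge. The first round labels it,
  whoever advances.
\<close>
lemma (in cherry_removal) tour_of_one_label:
  assumes T: "T \<in> labeled_trees 1" and S: "S \<in> labeled_trees 0" "ab_cherry S"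
    and "0 \<le> i" "length k = 1" "entry k 1 = 1"
  shows "T \<in> tour_trees k" "face_off T (leaf_edge_labeling T) v {v, x} {v, y} neck_edge i j"
proof -
  note TD = labeled_treesD[OF T]
  have j: "j = 1" "i = 0"
    using TD(4)[OF graft_facts(10)] label_y loser_less assms(4) by auto
  show first: "face_off T (leaf_edge_labeling T) v {v, x} {v, y} neck_edge i j"
    unfolding face_off_def
  proof (intro conjI allI impI)
    show "can_compete T (leaf_edge_labeling T) v {v, x} {v, y} neck_edge i j"
      using incident_T_v initial_labels_T graft_facts loser_less by (simp add: can_compete_def)
    fix u e f g a b assume c: "can_compete T (leaf_edge_labeling T) u e f g a b"
    obtain q where "q \<in> leaves T" "label T q = b"
      using initial_competitors[OF TD(1) c] by metis
    then have "b \<le> 1" using TD(4)[of q] by simp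
    moreover have "a < b" using c by (simp add: can_compete_def)
    ultimately show "a \<le> i" using j by simp
  qed
  define L where "L = (leaf_edge_labeling T)(neck_edge \<mapsto> advancing T (leaf_edge_labeling T) neck_edge i j)"
  have "lazy_rounds T L [(i, j)]"
    using lazy_rounds.round[OF lazy_rounds.start first] by (simp add: L_def)
  moreover have "L e \<noteq> None" if e: "e \<in> edges T" for e
  proof -
    consider "e = neck_edge" | "e = {v, x}" | "e = {v, y}" | "e \<in> edges S" "e \<noteq> neck_edge"
      using e graft_facts(7) by blast
    then show ?thesis
    proof cases
      case 4
      then have "v \<notin> e" using edge_S_at_v by blast
      then show ?thesis
        using initial_label_lift[OF 4(1)] no_inner_edge[OF S 4(1)] 4(2) by (simp add: L_def)
    qed (use initial_labels_T in \<open>auto simp: L_def\<close>)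
  qed
  ultimately have "lazy_tournament T L [(i, j)]"
    by (simp add: lazy_tournament_def)
  moreover have "\<forall>l\<in>{1..int (length k)}. rounds_won [(i, j)] l = entry k l"
    using assms(5,6) j by (auto simp: rounds_won_def)
  moreover have "ab_cherry T" using ab_cherry_iff[OF assms(4)] S(2) by simp
  ultimately show "T \<in> tour_trees k"
    using T assms(5) unfolding tour_trees_iff by auto
qed

text \<open>
  The map applied to the grafted tree \<open>T\<close> need not return \<open>S\<close> itself, since the two may differ
  in the values of the labeling at inner vertices. Both are \<open>T\<close> without its first cherry, and
  hence isomorphic.
\<close>
lemma pi_lazy_tree_preimage:
  assumes n: "1 \<le> n" and w: "weak_composition n k"
    and j: "rightmost_zero k < j" "j \<le> int n" and S: "S \<in> tour_trees (tilde k j)"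
  obtains T S' where "T \<in> tour_trees k" "pi_lazy_tree k T = (j, S')" "(S', S) \<in> tree_iso (n - 1)"
proof -
  define i where "i = rightmost_zero k"
  define m where "m = removed_label k j"
  have i: "0 \<le> i" "i < j" using rightmost_zero_props(1)[OF w] j by (simp_all add: i_def)
  have j1: "1 \<le> j" using i by simp
  note rl = removed_label_props[OF w j1 j(2,1), folded m_def]
  note rt = rightmost_zero_tilde[OF w j1 j(2,1), folded i_def]
  have len: "length k = n" "length (tilde k j) = n - 1"
    using w rt(1) by (simp_all add: weak_composition_def)
  have Sn: "S \<in> labeled_trees (n - 1)" "ab_cherry S"
    using S len by (simp_all add: tour_trees_iff)
  have kj: "1 \<le> entry k j" using rightmost_zero_props(4)[OF w] j by blast
  define a where "a = (if 1 < entry k j then j else i)"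
  have ma: "m = i \<and> a = j \<or> m = j \<and> a = i"
    by (simp add: m_def a_def i_def removed_label_def)
  then have a: "a \<noteq> m" "0 \<le> a" "a \<le> int n" using i j by auto
  have "m = i \<and> increase_from m (decrease_above m a) = j \<or>
      m = j \<and> increase_from m (decrease_above m a) = i"
    using ma increase_decrease[OF a(1)] by auto
  moreover have "decrease_above m a \<in> {-2..int (n - 1)}"
    using a rl(1,2) n by (auto simp: decrease_above_def)
  ultimately obtain T v x y where cr: "cherry_removal T S v x y i j m"
    using graft_exists[OF Sn(1) _ i(2)] by metis
  interpret cherry_removal T S v x y i j m by (rule cr)
  have Tn: "T \<in> labeled_trees n"
    using labeled_iff[OF n _ rl(2)] rl(1) Sn(1) by simp
  note TD = labeled_treesD[OF Tn]
  have "T \<in> tour_trees k \<and> face_off T (leaf_edge_labeling T) v {v, x} {v, y} neck_edge i j"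
  proof (cases "n = 1")
    case True
    then have "k = [1]"
      using w by (cases k) (auto simp: weak_composition_def)
    then show ?thesis
      using tour_of_one_label[of k] Tn Sn True i(1) by (simp add: entry_def)
  next
    case False
    then have N: "1 \<le> n - 1" using n by simp
    obtain L rs where "lazy_tournament S L rs" using S by (auto simp: tour_trees_iff)
    then obtain u e f g i' j' where S1: "face_off S (leaf_edge_labeling S) u e f g i' j'"
      using first_face_off_exists[OF Sn(1) N] by metis
    have i': "i' = rightmost_zero (tilde k j)"
      using first_face_off_of_tour(1)[OF N rt(1) S S1] .
    have bounds: "m = i \<Longrightarrow> i' < i" "m = j \<Longrightarrow> i' = i"
      using i' rt(2,3) i(2) kj by (auto simp: m_def i_def removed_label_def split: if_splits)
    note first = first_face_off_T[OF Sn(1) N TD(2) S1 bounds]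
    have "T \<in> tour_trees k"
      using tour_S_to_T[OF first i(1) rl(1) _ kj rl(3)] S rl(4) j len by simp
    then show ?thesis using first(1) by blast
  qed
  then have T: "T \<in> tour_trees k" and first: "face_off T (leaf_edge_labeling T) v {v, x} {v, y} neck_edge i j"
    by auto
  obtain x' y' S' where S': "pi_lazy_tree k T = (j, S')"
    "cherry_removal T S' v x' y' i j (if 1 < entry k j then i else j)"
    by (rule pi_lazy_tree_cherry[OF Tn first])
  have cr': "cherry_removal T S' v x' y' i j m"
    using S'(2) unfolding m_def i_def removed_label_def .
  have "isomorphic T T"
    using equiv_class_self[OF equiv_tree_iso Tn] by (simp add: tree_iso_def)
  then have "isomorphic S' S"
    using isomorphic_remove_cherries[OF cr' cr TD(2)] by blast
  moreover have "S' \<in> labeled_trees (n - 1)"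
    using cherry_removal.labeled_iff[OF cr' n _ rl(2)] rl(1) Tn by simp
  ultimately show thesis using that[OF T S'(1)] Sn(1) by (simp add: tree_iso_def)
qed

theorem proposition3p15:
  fixes n :: nat and k :: "nat list" and i :: int
  assumes "n \<ge> 1"
    and "weak_composition n k"
    and "i = rightmost_zero k"
  shows "bij_betw (pi_lazy k) (Tour k) (SIGMA j:{j \<in> {1..int n}. j > i}. Tour (tilde k j))"
proof -
  note n = assms(1) and w = assms(2)
  have len: "length k = n" using w by (simp add: weak_composition_def)
  have Tour_k: "Tour k = tour_trees k // tree_iso n" by (simp add: Tour_def len)
  have Tour_tilde: "Tour (tilde k j) = tour_trees (tilde k j) // tree_iso (n - 1)"
    if "rightmost_zero k < j" "j \<le> int n" for j
  proof -
    have "1 \<le> j" using that rightmost_zero_props(1)[OF w] by simp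
    then have "length (tilde k j) = n - 1"
      using rightmost_zero_tilde(1)[OF w _ that(2,1)] by (simp add: weak_composition_def)
    then show ?thesis by (simp add: Tour_def)
  qed
  have "inj_on (pi_lazy k) (Tour k)"
  proof (rule inj_onI)
    fix C C' assume C: "C \<in> Tour k" "C' \<in> Tour k" and eq: "pi_lazy k C = pi_lazy k C'"
    obtain T where T: "T \<in> tour_trees k" "C = tree_iso n `` {T}"
      using C(1) unfolding Tour_k by (rule quotientE)
    obtain T' where T': "T' \<in> tour_trees k" "C' = tree_iso n `` {T'}"
      using C(2) unfolding Tour_k by (rule quotientE)
    obtain S v x y g j where S: "pi_lazy_tree k T = (j, S)"
      "cherry_removal T S v x y (rightmost_zero k) j (removed_label k j)" "S \<in> labeled_trees (n - 1)"
      by (rule pi_lazy_tree_tour[OF n w T(1)])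
    obtain S' v' x' y' g' j' where S': "pi_lazy_tree k T' = (j', S')"
      "cherry_removal T' S' v' x' y' (rightmost_zero k) j' (removed_label k j')"
      "S' \<in> labeled_trees (n - 1)"
      by (rule pi_lazy_tree_tour[OF n w T'(1)])
    have "(j, tree_iso (n - 1) `` {S}) = (j', tree_iso (n - 1) `` {S'})"
      using eq pi_lazy_class[OF n w T(1) S(1)] pi_lazy_class[OF n w T'(1) S'(1)] T(2) T'(2) by simp
    then have jj: "j' = j" and "(S, S') \<in> tree_iso (n - 1)"
      using eq_equiv_class_iff[OF equiv_tree_iso S(3) S'(3)] by auto
    then have "isomorphic S S'" by (simp add: tree_iso_def)
    then have "isomorphic T T'"
      using isomorphic_graft_cherries[OF S(2) S'(2)[unfolded jj] labeled_treesD(2)[OF S'(3)]] by blast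
    then have "(T, T') \<in> tree_iso n"
      using T(1) T'(1) len by (simp add: tree_iso_def tour_trees_iff)
    then show "C = C'"
      using equiv_class_eq[OF equiv_tree_iso] T(2) T'(2) by simp
  qed
  moreover have "pi_lazy k ` Tour k = (SIGMA j:{j \<in> {1..int n}. j > i}. Tour (tilde k j))"
  proof (intro equalityI subsetI)
    fix z assume "z \<in> pi_lazy k ` Tour k"
    then obtain C where C: "C \<in> Tour k" "z = pi_lazy k C" by blast
    obtain T where T: "T \<in> tour_trees k" "C = tree_iso n `` {T}"
      using C(1) unfolding Tour_k by (rule quotientE)
    obtain S v x y g j where S: "pi_lazy_tree k T = (j, S)" "rightmost_zero k < j" "j \<le> int n"
      "S \<in> tour_trees (tilde k j)"
      by (rule pi_lazy_tree_tour[OF n w T(1)])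
    have "z = (j, tree_iso (n - 1) `` {S})"
      using C(2) T(2) pi_lazy_class[OF n w T(1) S(1)] by simp
    moreover have "tree_iso (n - 1) `` {S} \<in> Tour (tilde k j)"
      unfolding Tour_tilde[OF S(2,3)] by (rule quotientI[OF S(4)])
    ultimately show "z \<in> (SIGMA j:{j \<in> {1..int n}. j > i}. Tour (tilde k j))"
      using S(2,3) assms(3) rightmost_zero_props(1)[OF w] by simp
  next
    fix z assume "z \<in> (SIGMA j:{j \<in> {1..int n}. j > i}. Tour (tilde k j))"
    then obtain j D where z: "z = (j, D)" "rightmost_zero k < j" "j \<le> int n" "D \<in> Tour (tilde k j)"
      using assms(3) by auto
    obtain S where S: "S \<in> tour_trees (tilde k j)" "D = tree_iso (n - 1) `` {S}"
      using z(4) unfolding Tour_tilde[OF z(2,3)] by (rule quotientE)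
    obtain T S' where T: "T \<in> tour_trees k" "pi_lazy_tree k T = (j, S')" "(S', S) \<in> tree_iso (n - 1)"
      by (rule pi_lazy_tree_preimage[OF n w z(2,3) S(1)])
    have "z = pi_lazy k (tree_iso n `` {T})"
      using pi_lazy_class[OF n w T(1,2)] equiv_class_eq[OF equiv_tree_iso T(3)] z(1) S(2) by simp
    moreover have "tree_iso n `` {T} \<in> Tour k"
      unfolding Tour_k by (rule quotientI[OF T(1)])
    ultimately show "z \<in> pi_lazy k ` Tour k" by blast
  qed
  ultimately show ?thesis by (simp add: bij_betw_def)
qed

end
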